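(* Let $\epsilon\in(0,1)$, $C>0$ and $p\in[0,1]$ with $r=Cp\le 1-\epsilon$. The algorithm Linear_Bernoulli_Factory$(\epsilon,C)$ uses on average at most $7.57\,C\epsilon^{-1}$ flips of the $p$-coin to generate its output $B\sim\mathsf{Bern}(r)$.
   Context: $\mathsf{Bern}(q)$ is the distribution on $\{0,1\}$ with mass $q$ at $1$; $\mathsf{Exp}(\lambda)$ is the exponential distribution of rate $\lambda$. A $p$-coin with unknown $p\in[0,1]$ is available: its flips are iid $\mathsf{Bern}(p)$. "Coin flips" counts only flips of the $p$-coin; all other (auxiliary) random draws with known distributions are independent, free and not counted. All draws and all calls of subroutines use fresh independent randomness. Write $r=Cp$. Logistic_Bernoulli_Factory$(C)$: set $X\leftarrow0$, draw $A\sim\mathsf{Exp}(1)$, draw $T\sim\mathsf{Exp}(C)$. While $X=0$ and $T<A$: flip the $p$-coin to get $B\sim\mathsf{Bern}(p)$; if $B=1$ set $X\leftarrow1$, else increase $T$ by a fresh $\mathsf{Exp}(C)$ draw. Return $X$. A$(m,C)$: set $s\leftarrow1$. While $s\in\{1,\ldots,m-1\}$: draw $B\leftarrow$ Logistic_Bernoulli_Factory$(C)$ and set $s\leftarrow s-2B+1$. Return $1$ if $s=0$ and $0$ otherwise. High_Power_Logistic_BF$(m,\beta,C)$: set $s\leftarrow1$. While $s\in\{1,\ldots,m\}$: draw $B\leftarrow$ Logistic_Bernoulli_Factory$(\beta C)$ and set $s\leftarrow s+2B-1$. Return $1$ if $s=m+1$ and $0$ otherwise. (For $m=0$ it returns $1$.)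 B$(\epsilon,m,\beta,C)$: repeat the following until an output is returned: draw $B_1\leftarrow$ Linear_Bernoulli_Factory$(1-(1-\epsilon)\beta,\ \beta C)$; if $B_1=0$, return $0$; otherwise draw $B_2\leftarrow$ High_Power_Logistic_BF$(m-2,\beta,C)$; if $B_2=1$, return $1$; otherwise set $m\leftarrow m-1$ (with $\epsilon,\beta,C$ unchanged) and repeat. Linear_Bernoulli_Factory$(\epsilon,C)$: set $m\leftarrow\lceil4.5\,\epsilon^{-1}\rceil+1$ and $\beta\leftarrow1+1/(m-1)$. Draw $B_1\leftarrow$ A$(m,\beta C)$. If $B_1=0$, return $0$. If $B_1=1$, draw $B_2\sim\mathsf{Bern}(1/\beta)$; if $B_2=1$ return $1$; otherwise return the output of B$(\epsilon,m,\beta,C)$. (B and Linear_Bernoulli_Factory call each other recursively.) *)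

theory Defs
  imports "HOL-Probability.Probability" "HOL-Library.While_Combinator"
begin

text \<open>
  Every algorithm below denotes a subprobability distribution on pairs \<open>(output, flips)\<close>, where
  \<open>flips\<close> is the number of flips of the \<open>p\<close>-coin made during that run; the missing mass is the
  probability of not terminating. Bits are booleans. Sequencing in the \<open>spmf\<close> monad gives
  every draw and every subroutine call fresh independent randomness.
\<close>

subsection \<open>The logistic Bernoulli factory\<close>

definition exp_dist :: "real \<Rightarrow> real measure" where
  "exp_dist l = density lborel (exponential_density l)"

text \<open>
  One run of the loop as a function of all the randomness it may use: the threshold \<open>A\<close>, the
  initial value \<open>T\<close>, and a stream whose \<open>n\<close>-th entry is the result of the \<open>n\<close>-th coin flip together
  with the increment that is added to \<open>T\<close> if that flip fails. The state is \<open>(X, T, n)\<close>,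
  with \<open>n\<close> the number of flips so far; entries beyond the last flip are never read. The result is
  \<^term>\<open>None\<close> if the loop does not stop.
\<close>

definition logistic_run :: "real \<Rightarrow> real \<Rightarrow> (bool \<times> real) stream \<Rightarrow> (bool \<times> nat) option" where
  "logistic_run A T\<^sub>0 w =
     map_option (\<lambda>(X, T, n). (X, n))
       (while_option
         (\<lambda>(X, T, n). \<not> X \<and> T < A)
         (\<lambda>(X, T, n). if fst (w !! n) then (True, T, Suc n)
                      else (X, T + snd (w !! n), Suc n))
         (False, T\<^sub>0, 0))"

definition logistic_space :: "real \<Rightarrow> real \<Rightarrow> (real \<times> real \<times> (bool \<times> real) stream) measure" where
  "logistic_space p C =
     exp_dist 1 \<Otimes>\<^sub>M (exp_dist C \<Otimes>\<^sub>M
       stream_space (measure_pmf (bernoulli_pmf p) \<Otimes>\<^sub>M exp_dist C))"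

definition logistic_bf :: "real \<Rightarrow> real \<Rightarrow> (bool \<times> nat) spmf" where
  "logistic_bf p C =
     embed_spmf (\<lambda>y. measure (logistic_space p C)
       {\<omega> \<in> space (logistic_space p C). case \<omega> of (A, T\<^sub>0, w) \<Rightarrow> logistic_run A T\<^sub>0 w = Some y})"

subsection \<open>The two random walks\<close>

partial_function (spmf) walk_A :: "real \<Rightarrow> int \<Rightarrow> real \<Rightarrow> int \<Rightarrow> (bool \<times> nat) spmf" where
  "walk_A p m C s =
     (if s \<in> {1..m - 1}
      then do {
        (b, k) \<leftarrow> logistic_bf p C;
        (x, l) \<leftarrow> walk_A p m C (s - 2 * of_bool b + 1);
        return_spmf (x, k + l)
      }
      else return_spmf (s = 0, 0))"

definition alg_A :: "real \<Rightarrow> int \<Rightarrow> real \<Rightarrow> (bool \<times> nat) spmf" where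
  "alg_A p m C = walk_A p m C 1"

partial_function (spmf) walk_HP :: "real \<Rightarrow> int \<Rightarrow> real \<Rightarrow> real \<Rightarrow> int \<Rightarrow> (bool \<times> nat) spmf" where
  "walk_HP p m \<beta> C s =
     (if s \<in> {1..m}
      then do {
        (b, k) \<leftarrow> logistic_bf p (\<beta> * C);
        (x, l) \<leftarrow> walk_HP p m \<beta> C (s + 2 * of_bool b - 1);
        return_spmf (x, k + l)
      }
      else return_spmf (s = m + 1, 0))"

definition high_power_logistic_bf :: "real \<Rightarrow> int \<Rightarrow> real \<Rightarrow> real \<Rightarrow> (bool \<times> nat) spmf" where
  "high_power_logistic_bf p m \<beta> C = walk_HP p m \<beta> C 1"

subsection \<open>The mutually recursive algorithms\<close>

text \<open>
  \<open>Linear_Call \<epsilon> C\<close> is a call of the linear factory and \<open>B_Call \<epsilon> m \<beta> C\<close> is the entry of an iteration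
  of the loop of algorithm B with current value \<open>m\<close>. A single recursion over calls is used because
  the package for partial functions does not support mutual recursion; the intended pair of mutually
  recursive equations is \<open>linear_bf_eq\<close> and \<open>alg_B_eq\<close> below.
\<close>

datatype bf_call = Linear_Call real real | B_Call real int real real

partial_function (spmf) run_call :: "real \<Rightarrow> bf_call \<Rightarrow> (bool \<times> nat) spmf" where
  "run_call p c =
     (case c of
        Linear_Call \<epsilon> C \<Rightarrow>
          (let m = \<lceil>4.5 / \<epsilon>\<rceil> + 1; \<beta> = 1 + 1 / (of_int m - 1) in
           do {
             (b1, k1) \<leftarrow> alg_A p m (\<beta> * C);
             if \<not> b1 then return_spmf (False, k1)
             else do {
               b2 \<leftarrow> spmf_of_pmf (bernoulli_pmf (1 / \<beta>));
               if b2 then return_spmf (True, k1)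
               else do {
                 (b, k) \<leftarrow> run_call p (B_Call \<epsilon> m \<beta> C);
                 return_spmf (b, k1 + k)
               }
             }
           })
      | B_Call \<epsilon> m \<beta> C \<Rightarrow>
          do {
            (b1, k1) \<leftarrow> run_call p (Linear_Call (1 - (1 - \<epsilon>) * \<beta>) (\<beta> * C));
            if \<not> b1 then return_spmf (False, k1)
            else do {
              (b2, k2) \<leftarrow> high_power_logistic_bf p (m - 2) \<beta> C;
              if b2 then return_spmf (True, k1 + k2)
              else do {
                (b, k) \<leftarrow> run_call p (B_Call \<epsilon> (m - 1) \<beta> C);
                return_spmf (b, k1 + k2 + k)
              }
            }
          })"

definition linear_bf :: "real \<Rightarrow> real \<Rightarrow> real \<Rightarrow> (bool \<times> nat) spmf" where
  "linear_bf p \<epsilon> C = run_call p (Linear_Call \<epsilon> C)"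

definition alg_B :: "real \<Rightarrow> real \<Rightarrow> int \<Rightarrow> real \<Rightarrow> real \<Rightarrow> (bool \<times> nat) spmf" where
  "alg_B p \<epsilon> m \<beta> C = run_call p (B_Call \<epsilon> m \<beta> C)"

lemma linear_bf_eq:
  "linear_bf p \<epsilon> C =
     (let m = \<lceil>4.5 / \<epsilon>\<rceil> + 1; \<beta> = 1 + 1 / (of_int m - 1) in
      do {
        (b1, k1) \<leftarrow> alg_A p m (\<beta> * C);
        if \<not> b1 then return_spmf (False, k1)
        else do {
          b2 \<leftarrow> spmf_of_pmf (bernoulli_pmf (1 / \<beta>));
          if b2 then return_spmf (True, k1)
          else do {
            (b, k) \<leftarrow> alg_B p \<epsilon> m \<beta> C;
            return_spmf (b, k1 + k)
          }
        }
      })"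
  unfolding linear_bf_def alg_B_def by (subst run_call.simps) simp

lemma alg_B_eq:
  "alg_B p \<epsilon> m \<beta> C =
     do {
       (b1, k1) \<leftarrow> linear_bf p (1 - (1 - \<epsilon>) * \<beta>) (\<beta> * C);
       if \<not> b1 then return_spmf (False, k1)
       else do {
         (b2, k2) \<leftarrow> high_power_logistic_bf p (m - 2) \<beta> C;
         if b2 then return_spmf (True, k1 + k2)
         else do {
           (b, k) \<leftarrow> alg_B p \<epsilon> (m - 1) \<beta> C;
           return_spmf (b, k1 + k2 + k)
         }
       }
     }"
  unfolding linear_bf_def alg_B_def by (subst run_call.simps) simp

text \<open>
  Only terminating runs contribute, so this is the expected number of flips of the algorithm when
  \<open>P\<close> is lossless.
\<close>

definition expected_flips :: "(bool \<times> nat) spmf \<Rightarrow> ennreal" where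
  "expected_flips P = (\<integral>\<^sup>+ y. of_nat (snd y) \<partial>measure_spmf P)"

end

theory Submission
  imports Defs
begin

text \<open>
  Write \<open>r = C p\<close>, \<open>n = \<lceil>4.5 / \<epsilon>\<rceil>\<close> (so \<open>m = n + 1\<close>), \<open>\<beta> = 1 + 1 / n\<close>, \<open>\<rho> = \<beta> r\<close> and
  \<open>S k = 1 + \<rho> + \<dots> + \<rho> ^ (k - 1)\<close>.

  \<^bold>\<open>Building blocks.\<close> By the memoryless property (\<open>memoryless_nn_integral\<close>) every test \<open>T < A\<close> of
  the logistic factory succeeds with probability \<open>C / (1 + C)\<close>, independently of the past. Its
  number of flips is therefore geometric; it outputs 1 with probability \<open>r / (1 + r)\<close> and makes
  \<open>C / (1 + r)\<close> flips on average. A walk driven by such draws at rate \<open>\<beta> C\<close> is a gambler's ruin with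
  odds \<open>\<rho> : 1\<close> for going down: on \<open>{0..M}\<close> it is absorbed at 0 from \<open>s\<close> with probability
  \<open>\<rho> ^ s * S (M - s) / S M\<close> (\<open>cost_bound_walk_A\<close>). The walk of the high power factory is the same
  walk reflected.

  \<^bold>\<open>Output.\<close> Walk A returns 1 with probability \<open>\<rho> * S n / S (n + 1)\<close>, of which the fraction
  \<open>1 / \<beta> = n / (n + 1)\<close> is accepted at once. Algorithm B, with \<open>k\<close> in place of \<open>m - 1\<close>, succeeds
  with probability \<open>k * \<rho> ^ k / S k\<close>: this solves the recursion \<open>b k = \<rho> * (h + (1 - h) * b (k - 1))\<close>
  where \<open>h = \<rho> ^ (k - 1) / S k\<close> is the success probability of the high power factory. In total
  \<open>\<rho> * n / (n + 1) * (S n + \<rho> ^ n) / S (n + 1) = r\<close>.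

  \<^bold>\<open>Flips.\<close> Let \<open>R = (\<Sum>k\<le>n. k * \<rho> ^ k) / ((n + 1) * S (n + 1))\<close>. One call of the linear factory makes
  \<open>R\<close> inner calls on average, and walk A makes \<open>\<beta> C (n - (n + 1) R)\<close> flips: large values of \<open>\<rho>\<close> cause
  many inner calls but shorten the walk. With this trade-off, \<open>K C / \<epsilon>\<close> with \<open>K = 7.57\<close> is a
  supersolution of the recursion for the number of flips (\<open>cost_recursion\<close>), because the gap
  \<open>\<epsilon>' = 1 - (1 - \<epsilon>) \<beta>\<close> of the inner call is at least \<open>7 \<epsilon> / 9\<close> and \<open>\<beta> R \<le> 2 / 7 * (1 - \<epsilon>)\<close>.

  \<^bold>\<open>The circular definition.\<close> The algorithms are a least fixed point, so only upper bounds that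
  survive one unfolding and suprema of chains can be had by induction. The three bounds
  \<open>P(1) \<le> r\<close>, \<open>P(0) \<le> 1 - r\<close> and \<open>flips \<le> K C / \<epsilon>\<close> are of this kind and compose along the program
  (\<open>cost_bound_seq\<close>, \<open>within_budget_run_call\<close>). The first two become equalities as soon as the
  algorithm terminates almost surely, and it does: if inner calls diverge with probability at most
  \<open>\<delta>\<close>, then the call itself diverges with probability at most \<open>R \<delta> \<le> \<delta> / 2\<close>, and iterating this
  drives the probability of divergence to 0 (\<open>linear_bf_lossless\<close>).
\<close>

section \<open>The law of the logistic factory\<close>

text \<open>
  The loop reads the stream through the flip counter, so after one iteration it runs on the tail of
  the stream with the counter shifted by one. This turns the loop into a recursion on streams.
\<close>

lemma logistic_run_unfold:
  "logistic_run a t w =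
     (if t < a then
        if fst (shd w) then Some (True, 1)
        else map_option (\<lambda>(b, n). (b, Suc n)) (logistic_run a (t + snd (shd w)) (stl w))
      else Some (False, 0))"
proof -
  define c where "c w = (\<lambda>(X, T, n). if fst (w !! n) then (True, T, Suc n)
      else (X, T + snd (w !! n), Suc n))" for w :: "(bool \<times> real) stream"
  define g where "g = (\<lambda>(X :: bool, T, n :: nat). \<not> X \<and> T < a)"
  have shift: "while_option g (c w) (X, T, Suc 0) =
      map_option (\<lambda>(X, T, n). (X, T, Suc n)) (while_option g (c (stl w)) (X, T, 0))" for X T
  proof -
    have "map_option (\<lambda>(X, T, n). (X, T, Suc n)) (while_option g (c (stl w)) (X, T, 0)) =
        while_option g (c w) ((\<lambda>(X, T, n). (X, T, Suc n)) (X, T, 0))"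
      by (rule while_option_commute) (auto simp: g_def c_def)
    then show ?thesis by simp
  qed
  have run: "logistic_run a t w = map_option (\<lambda>(X, T, n). (X, n)) (while_option g (c w) (False, t, 0))"
    for t w by (simp add: logistic_run_def g_def c_def)
  consider "\<not> t < a" | "t < a" "fst (shd w)" | "t < a" "\<not> fst (shd w)" by blast
  then show ?thesis
  proof cases
    case 3
    have "while_option g (c w) (False, t, 0) = while_option g (c w) (False, t + snd (shd w), Suc 0)"
      using 3 by (subst while_option_unfold) (simp add: g_def c_def)
    then show ?thesis using 3
      by (simp add: run shift option.map_comp comp_def case_prod_beta)
  next
    case 2
    then have "while_option g (c w) (False, t, 0) = while_option g (c w) (True, t, Suc 0)"
      by (subst while_option_unfold) (simp add: g_def c_def)
    also have "\<dots> = Some (True, t, Suc 0)"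
      by (subst while_option_unfold) (simp add: g_def)
    finally show ?thesis using 2 by (simp add: run)
  next
    case 1
    then show ?thesis
      unfolding run by (subst while_option_unfold) (simp add: g_def)
  qed
qed

lemma logistic_run_eq_0:
  "logistic_run a t w = Some (b, 0) \<longleftrightarrow> \<not> b \<and> \<not> t < a"
  by (subst logistic_run_unfold) auto

lemma logistic_run_eq_Suc:
  "logistic_run a t w = Some (b, Suc n) \<longleftrightarrow>
     t < a \<and> (if fst (shd w) then b \<and> n = 0
               else logistic_run a (t + snd (shd w)) (stl w) = Some (b, n))"
  by (subst logistic_run_unfold) auto

text \<open>
  Only \<open>a - T\<close> matters for the loop test. Conditionally on passing the first test, this brings
  the run back to its initial form.
\<close>

lemma logistic_run_translate:
  "logistic_run a (t + x) w = Some (b, n) \<longleftrightarrow> logistic_run (a - t) x w = Some (b, n)"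
proof (induction n arbitrary: x w)
  case 0
  show ?case by (auto simp: logistic_run_eq_0)
next
  case (Suc n)
  show ?case
    using Suc.IH[of "x + snd (shd w)" "stl w"] by (auto simp: logistic_run_eq_Suc add.assoc)
qed

abbreviation flip_stream :: "real \<Rightarrow> real \<Rightarrow> (bool \<times> real) stream measure" where
  "flip_stream p C \<equiv> stream_space (measure_pmf (bernoulli_pmf p) \<Otimes>\<^sub>M exp_dist C)"

lemma sets_exp_dist [measurable_cong, simp]: "sets (exp_dist l) = sets borel"
  by (simp add: exp_dist_def)

lemma space_exp_dist [simp]: "space (exp_dist l) = UNIV"
  by (simp add: exp_dist_def)

lemma prob_space_exp_dist: "0 < l \<Longrightarrow> prob_space (exp_dist l)"
  unfolding exp_dist_def by (rule prob_space_exponential_density)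

lemma nn_integral_exp_dist:
  assumes [measurable]: "f \<in> borel_measurable borel"
  shows "(\<integral>\<^sup>+ x. f x \<partial>exp_dist l) = (\<integral>\<^sup>+ x. ennreal (exponential_density l x) * f x \<partial>lborel)"
  unfolding exp_dist_def by (subst nn_integral_density) auto

lemma measurable_logistic_run [measurable]:
  "Measurable.pred (borel \<Otimes>\<^sub>M borel \<Otimes>\<^sub>M stream_space (count_space UNIV \<Otimes>\<^sub>M borel))
     (\<lambda>(a, t, w). logistic_run a t w = Some (b, n))"
proof (induction n)
  case 0
  show ?case unfolding logistic_run_eq_0 case_prod_beta by measurable
next
  case (Suc n)
  note [measurable] = Suc.IH
  let ?S = "stream_space (count_space (UNIV :: bool set) \<Otimes>\<^sub>M (borel :: real measure))"
  let ?M = "(borel :: real measure) \<Otimes>\<^sub>M (borel :: real measure) \<Otimes>\<^sub>M ?S"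
  have [measurable]: "(\<lambda>x. shd (snd (snd x))) \<in> ?M \<rightarrow>\<^sub>M count_space UNIV \<Otimes>\<^sub>M borel"
    by (rule measurable_compose[OF _ measurable_shd]) measurable
  have [measurable]: "(\<lambda>x. stl (snd (snd x))) \<in> ?M \<rightarrow>\<^sub>M ?S"
    by (rule measurable_compose[OF _ measurable_stl]) measurable
  have "(\<lambda>(a :: real, t, w). (a, t + snd (shd w), stl w)) \<in> ?M \<rightarrow>\<^sub>M ?M"
    unfolding case_prod_beta by measurable
  from measurable_compose[OF this Suc.IH]
  have [measurable]: "Measurable.pred (borel \<Otimes>\<^sub>M borel \<Otimes>\<^sub>M stream_space (count_space UNIV \<Otimes>\<^sub>M borel))
     (\<lambda>x. logistic_run (fst x) (fst (snd x) + snd (shd (snd (snd x)))) (stl (snd (snd x))) = Some (b, n))"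
    by (simp only: case_prod_beta fst_conv snd_conv)
  show ?case
    unfolding logistic_run_eq_Suc case_prod_beta by measurable
qed

lemma sets_flip_stream [measurable_cong]:
  "sets (flip_stream p C) = sets (stream_space (count_space UNIV \<Otimes>\<^sub>M borel))"
  by (intro sets_stream_space_cong sets_pair_measure_cong) simp_all

text \<open>
  Given that an arrival at rate \<open>C\<close> comes before the unit rate threshold, the remaining time
  \<open>a - t\<close> is again a unit rate exponential variable, and \<open>C / (1 + C)\<close> is the probability of that event.
\<close>

lemma memoryless_nn_integral:
  assumes C: "0 < C" and [measurable]: "f \<in> borel_measurable borel"
  shows "(\<integral>\<^sup>+ a. (\<integral>\<^sup>+ t. indicator {t. t < a} t * f (a - t) \<partial>exp_dist C) \<partial>exp_dist 1) =
    ennreal (C / (1 + C)) * (\<integral>\<^sup>+ a. f a \<partial>exp_dist 1)"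
proof -
  let ?d = exponential_density
  have inner: "(\<integral>\<^sup>+ a. ennreal (?d 1 a) * (ennreal (?d C t) * (indicator {t. t < a} t * f (a - t))) \<partial>lborel)
      = ennreal (?d C t * exp (- t)) * (\<integral>\<^sup>+ a. ennreal (?d 1 a) * f a \<partial>lborel)" for t
  proof (cases "t < 0")
    case True
    then show ?thesis by (simp add: exponential_density_def)
  next
    case False
    have "(\<integral>\<^sup>+ a. ennreal (?d 1 a) * (ennreal (?d C t) * (indicator {t. t < a} t * f (a - t))) \<partial>lborel)
      = (\<integral>\<^sup>+ u. ennreal (?d 1 (t + u)) * (ennreal (?d C t) * (indicator {t' . t' < t + u} t * f u)) \<partial>lborel)"
      by (subst nn_integral_real_affine[where c = 1 and t = t]) auto
    also have "\<dots> = (\<integral>\<^sup>+ u. ennreal (?d C t * exp (- t)) * (ennreal (?d 1 u) * f u) \<partial>lborel)"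
    proof (rule nn_integral_cong_AE)
      \<comment> \<open>At u = 0 the strict test fails while the density of the remaining time is positive.\<close>
      show "AE u in lborel. ennreal (?d 1 (t + u)) * (ennreal (?d C t) * (indicator {t' . t' < t + u} t * f u))
        = ennreal (?d C t * exp (- t)) * (ennreal (?d 1 u) * f u)"
        using AE_lborel_singleton[of "0 :: real"]
      proof eventually_elim
        case (elim u)
        then consider "u < 0" | "0 < u" by linarith
        then show ?case
        proof cases
          case 2
          have "ennreal (?d 1 (t + u)) = ennreal (exp (- t)) * ennreal (?d 1 u)"
            using 2 False by (simp add: exponential_density_def ennreal_mult[symmetric] exp_add[symmetric])
          moreover have "ennreal (?d C t * exp (- t)) = ennreal (?d C t) * ennreal (exp (- t))"
            using exponential_density_nonneg[OF C] by (intro ennreal_mult) auto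
          ultimately show ?thesis using 2 by (simp add: ac_simps)
        qed (simp add: exponential_density_def)
      qed
    qed
    also have "\<dots> = ennreal (?d C t * exp (- t)) * (\<integral>\<^sup>+ a. ennreal (?d 1 a) * f a \<partial>lborel)"
      by (subst nn_integral_cmult) auto
    finally show ?thesis .
  qed
  have total: "(\<integral>\<^sup>+ t. ennreal (?d C t * exp (- t)) \<partial>lborel) = ennreal (C / (1 + C))"
  proof -
    have "(\<integral>\<^sup>+ t. ennreal (?d C t * exp (- t)) \<partial>lborel) =
        (\<integral>\<^sup>+ t. ennreal (C / (1 + C)) * ennreal (?d (1 + C) t) \<partial>lborel)"
      using C by (intro nn_integral_cong)
        (auto simp: exponential_density_def ennreal_mult[symmetric] exp_add[symmetric] field_simps)
    also have "\<dots> = ennreal (C / (1 + C)) * (\<integral>\<^sup>+ t. ennreal (?d (1 + C) t) \<partial>lborel)"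
      by (subst nn_integral_cmult) auto
    also have "(\<integral>\<^sup>+ t. ennreal (?d (1 + C) t) \<partial>lborel) = 1"
      using prob_space.emeasure_space_1[OF prob_space_exponential_density[of "1 + C"]] C
      by (simp add: emeasure_density)
    finally show ?thesis by simp
  qed
  have [measurable]: "(\<lambda>x :: real \<times> real. indicator {t. t < fst x} (snd x) :: ennreal) \<in> borel_measurable (borel \<Otimes>\<^sub>M borel)"
    unfolding indicator_def by measurable
  have [measurable]: "(\<lambda>t. indicator {t. t < a} t * f (a - t)) \<in> borel_measurable borel" for a
    by measurable
  have [measurable]: "(\<lambda>a. \<integral>\<^sup>+ t. ennreal (?d C t) * (indicator {t. t < a} t * f (a - t)) \<partial>lborel) \<in> borel_measurable borel"
    by measurable
  have "(\<integral>\<^sup>+ a. (\<integral>\<^sup>+ t. indicator {t. t < a} t * f (a - t) \<partial>exp_dist C) \<partial>exp_dist 1) =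
    (\<integral>\<^sup>+ a. (\<integral>\<^sup>+ t. ennreal (?d 1 a) * (ennreal (?d C t) * (indicator {t. t < a} t * f (a - t))) \<partial>lborel) \<partial>lborel)"
    by (simp add: nn_integral_exp_dist nn_integral_cmult)
  also have "\<dots> = (\<integral>\<^sup>+ t. (\<integral>\<^sup>+ a. ennreal (?d 1 a) * (ennreal (?d C t) * (indicator {t. t < a} t * f (a - t))) \<partial>lborel) \<partial>lborel)"
    by (rule lborel_pair.Fubini') (measurable)
  also have "\<dots> = (\<integral>\<^sup>+ t. ennreal (?d C t * exp (- t)) \<partial>lborel) * (\<integral>\<^sup>+ a. ennreal (?d 1 a) * f a \<partial>lborel)"
    unfolding inner by (subst nn_integral_multc) auto
  finally show ?thesis by (simp add: total nn_integral_exp_dist)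
qed

lemma prob_space_flips: "0 < C \<Longrightarrow> prob_space (measure_pmf (bernoulli_pmf p) \<Otimes>\<^sub>M exp_dist C)"
  by (intro prob_space_pair prob_space_measure_pmf prob_space_exp_dist)

lemma prob_space_flip_stream: "0 < C \<Longrightarrow> prob_space (flip_stream p C)"
  by (intro prob_space.prob_space_stream_space prob_space_flips)

definition stop_prob :: "real \<Rightarrow> real \<Rightarrow> bool \<times> nat \<Rightarrow> real \<Rightarrow> real \<Rightarrow> ennreal" where
  "stop_prob p C y a t = (\<integral>\<^sup>+ w. indicator {w. logistic_run a t w = Some y} w \<partial>flip_stream p C)"

lemma measurable_logistic_run_indicator [measurable]:
  "(\<lambda>x. indicator {w. logistic_run (fst x) (fst (snd x)) w = Some y} (snd (snd x)) :: ennreal)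
    \<in> borel_measurable (borel \<Otimes>\<^sub>M borel \<Otimes>\<^sub>M flip_stream p C)"
proof -
  have [measurable]: "Measurable.pred (borel \<Otimes>\<^sub>M borel \<Otimes>\<^sub>M flip_stream p C)
      (\<lambda>x. logistic_run (fst x) (fst (snd x)) (snd (snd x)) = Some y)"
    using measurable_logistic_run[of "fst y" "snd y"]
    by (subst measurable_cong_sets[OF sets_pair_measure_cong[OF refl sets_pair_measure_cong[OF refl sets_flip_stream]] refl])
      (simp add: case_prod_unfold)
  show ?thesis
    unfolding indicator_def mem_Collect_eq by measurable
qed

lemma measurable_stop_prob [measurable]:
  assumes "0 < C"
  shows "(\<lambda>x. stop_prob p C y (fst x) (snd x)) \<in> borel_measurable (borel \<Otimes>\<^sub>M borel)"
proof -
  interpret S: prob_space "flip_stream p C" by (rule prob_space_flip_stream[OF assms])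
  have "(\<lambda>x. (fst (fst x), snd (fst x), snd x)) \<in>
     (borel \<Otimes>\<^sub>M borel) \<Otimes>\<^sub>M flip_stream p C \<rightarrow>\<^sub>M borel \<Otimes>\<^sub>M borel \<Otimes>\<^sub>M flip_stream p C"
    by measurable
  from measurable_compose[OF this measurable_logistic_run_indicator[of y]]
  show ?thesis unfolding stop_prob_def
    by (intro S.borel_measurable_nn_integral) (simp add: case_prod_beta)
qed

lemma stop_prob_0:
  assumes "0 < C"
  shows "stop_prob p C (b, 0) a t = (if \<not> b \<and> \<not> t < a then 1 else 0)"
  using prob_space.emeasure_space_1[OF prob_space_flip_stream[OF assms, of p]]
  by (simp add: stop_prob_def logistic_run_eq_0)

lemma stop_prob_translate: "stop_prob p C y a (t + x) = stop_prob p C y (a - t) x"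
  by (cases y) (simp add: stop_prob_def logistic_run_translate)

lemma stop_prob_Suc:
  assumes C: "0 < C" and p: "0 \<le> p" "p \<le> 1"
  shows "stop_prob p C (b, Suc n) a t = indicator {t. t < a} t *
    (ennreal p * (if b \<and> n = 0 then 1 else 0) +
     ennreal (1 - p) * (\<integral>\<^sup>+ x. stop_prob p C (b, n) (a - t) x \<partial>exp_dist C))"
proof -
  interpret S: prob_space "flip_stream p C" by (rule prob_space_flip_stream[OF C])
  interpret E: prob_space "exp_dist C" by (rule prob_space_exp_dist[OF C])
  interpret D: prob_space "measure_pmf (bernoulli_pmf p) \<Otimes>\<^sub>M exp_dist C"
    by (rule prob_space_flips[OF C])
  have [measurable]: "(\<lambda>w. indicator {w. logistic_run a t w = Some y} w :: ennreal)
      \<in> borel_measurable (flip_stream p C)" for y a t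
    by (rule measurable_compose[OF _ measurable_logistic_run_indicator[of y], of "\<lambda>w. (a, t, w)", simplified]) measurable
  have [measurable]: "(\<lambda>x. stop_prob p C (b, n) a (t + x)) \<in> borel_measurable borel"
    using measurable_compose[OF _ measurable_stop_prob[OF C, of p "(b, n)"], of "\<lambda>x. (a, t + x)" borel] by simp
  have "stop_prob p C (b, Suc n) a t =
    (\<integral>\<^sup>+ d. (\<integral>\<^sup>+ w. indicator {w. logistic_run a t w = Some (b, Suc n)} (d ## w) \<partial>flip_stream p C)
       \<partial>(measure_pmf (bernoulli_pmf p) \<Otimes>\<^sub>M exp_dist C))"
    unfolding stop_prob_def by (rule D.nn_integral_stream_space) measurable
  also have "\<dots> = (\<integral>\<^sup>+ d. indicator {t. t < a} t *
      (if fst d then (if b \<and> n = 0 then 1 else 0) else stop_prob p C (b, n) a (t + snd d))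
       \<partial>(measure_pmf (bernoulli_pmf p) \<Otimes>\<^sub>M exp_dist C))"
    by (intro nn_integral_cong)
      (auto simp: logistic_run_eq_Suc stop_prob_def S.emeasure_space_1 indicator_def intro!: nn_integral_cong)
  also have "\<dots> = (\<integral>\<^sup>+ c. (\<integral>\<^sup>+ x. indicator {t. t < a} t *
      (if c then (if b \<and> n = 0 then 1 else 0) else stop_prob p C (b, n) a (t + x)) \<partial>exp_dist C)
       \<partial>measure_pmf (bernoulli_pmf p))"
    by (subst E.nn_integral_fst[symmetric]) (measurable, simp only: fst_conv snd_conv cong del: if_weak_cong)
  also have "\<dots> = indicator {t. t < a} t *
    (ennreal p * (if b \<and> n = 0 then 1 else 0) +
     ennreal (1 - p) * (\<integral>\<^sup>+ x. stop_prob p C (b, n) a (t + x) \<partial>exp_dist C))"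
    using p E.emeasure_space_1
    by (subst nn_integral_measure_pmf_support[of "UNIV :: bool set"])
       (auto simp: UNIV_bool nn_integral_cmult mult.commute split: split_indicator)
  finally show ?thesis by (simp add: stop_prob_translate)
qed

text \<open>
  The probability of the result \<open>y\<close>, written in the order of integration in which the memoryless
  property of the threshold applies.
\<close>

definition stop_mass :: "real \<Rightarrow> real \<Rightarrow> bool \<times> nat \<Rightarrow> ennreal" where
  "stop_mass p C y = (\<integral>\<^sup>+ a. (\<integral>\<^sup>+ t. stop_prob p C y a t \<partial>exp_dist C) \<partial>exp_dist 1)"

lemma measurable_stop_prob_arrival [measurable]:
  assumes C: "0 < C"
  shows "(\<lambda>a. \<integral>\<^sup>+ t. stop_prob p C y a t \<partial>exp_dist C) \<in> borel_measurable borel"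
proof -
  interpret E: prob_space "exp_dist C" by (rule prob_space_exp_dist[OF C])
  have "(\<lambda>x. stop_prob p C y (fst x) (snd x)) \<in> borel_measurable (borel \<Otimes>\<^sub>M exp_dist C)"
    using measurable_stop_prob[OF C, of p y]
    by (subst measurable_cong_sets[OF sets_pair_measure_cong[OF refl sets_exp_dist] refl]) auto
  then show ?thesis
    by (intro E.borel_measurable_nn_integral) (simp add: case_prod_beta)
qed

text \<open>
  One iteration contributes the factor \<open>C / (1 + C)\<close> for passing the test and a coin flip; after that
  the memoryless property makes the rest of the run a fresh call.
\<close>

lemma stop_mass_Suc:
  assumes C: "0 < C" and p: "0 \<le> p" "p \<le> 1"
  shows "stop_mass p C (b, Suc n) = ennreal (C / (1 + C)) *
    (ennreal p * (if b \<and> n = 0 then 1 else 0) + ennreal (1 - p) * stop_mass p C (b, n))"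
proof -
  note [measurable] = measurable_stop_prob_arrival[OF C]
  show ?thesis
    using prob_space.emeasure_space_1[OF prob_space_exp_dist[of 1]]
    unfolding stop_mass_def stop_prob_Suc[OF assms]
    by (subst memoryless_nn_integral[OF C]) (auto simp: nn_integral_add nn_integral_cmult)
qed

lemma stop_mass_0:
  assumes C: "0 < C"
  shows "stop_mass p C (b, 0) = (if b then 0 else ennreal (1 / (1 + C)))"
proof (cases b)
  case False
  interpret E: prob_space "exp_dist C" by (rule prob_space_exp_dist[OF C])
  interpret A: prob_space "exp_dist 1" by (rule prob_space_exp_dist) simp
  have [measurable]: "(\<lambda>a. \<integral>\<^sup>+ t. indicator {t. t < a} t \<partial>exp_dist C) \<in> borel_measurable borel"
  proof -
    have "(\<lambda>x :: real \<times> real. indicator {t. t < fst x} (snd x) :: ennreal) \<in> borel_measurable (borel \<Otimes>\<^sub>M exp_dist C)"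
      unfolding indicator_def mem_Collect_eq by measurable
    then show ?thesis
      by (intro E.borel_measurable_nn_integral) (simp add: case_prod_beta)
  qed
  note [measurable] = measurable_stop_prob_arrival[OF C]
  \<comment> \<open>Stopping without any flip is the complement of passing the first test.\<close>
  have "stop_mass p C (b, 0) + (\<integral>\<^sup>+ a. (\<integral>\<^sup>+ t. indicator {t. t < a} t \<partial>exp_dist C) \<partial>exp_dist 1) =
    (\<integral>\<^sup>+ a. (\<integral>\<^sup>+ t. stop_prob p C (b, 0) a t \<partial>exp_dist C) + (\<integral>\<^sup>+ t. indicator {t. t < a} t \<partial>exp_dist C) \<partial>exp_dist 1)"
    unfolding stop_mass_def by (subst nn_integral_add) auto
  also have "\<dots> = (\<integral>\<^sup>+ a. (\<integral>\<^sup>+ t. 1 \<partial>exp_dist C) \<partial>exp_dist 1)"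
  proof (rule nn_integral_cong)
    fix a
    have "(\<integral>\<^sup>+ t. stop_prob p C (b, 0) a t \<partial>exp_dist C) + (\<integral>\<^sup>+ t. indicator {t. t < a} t \<partial>exp_dist C)
      = (\<integral>\<^sup>+ t. stop_prob p C (b, 0) a t + indicator {t. t < a} t \<partial>exp_dist C)"
      unfolding stop_prob_0[OF C] by (subst nn_integral_add) auto
    also have "\<dots> = (\<integral>\<^sup>+ t. 1 \<partial>exp_dist C)"
      using False by (intro nn_integral_cong) (auto simp: stop_prob_0[OF C])
    finally show "(\<integral>\<^sup>+ t. stop_prob p C (b, 0) a t \<partial>exp_dist C) + (\<integral>\<^sup>+ t. indicator {t. t < a} t \<partial>exp_dist C) =
      (\<integral>\<^sup>+ t. 1 \<partial>exp_dist C)" .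
  qed
  also have "\<dots> = 1" using E.emeasure_space_1 A.emeasure_space_1 by simp
  also have "(\<integral>\<^sup>+ a. (\<integral>\<^sup>+ t. indicator {t. t < a} t \<partial>exp_dist C) \<partial>exp_dist 1) = ennreal (C / (1 + C))"
    using memoryless_nn_integral[OF C, of "\<lambda>_. 1"] A.emeasure_space_1 by simp
  finally have *: "stop_mass p C (b, 0) + ennreal (C / (1 + C)) = 1" .
  then have "stop_mass p C (b, 0) = 1 - ennreal (C / (1 + C))"
    by (metis ennreal_add_diff_cancel_right ennreal_neq_top)
  also have "\<dots> = ennreal (1 - C / (1 + C))"
    using C by (subst ennreal_1[symmetric], subst ennreal_minus) auto
  also have "1 - C / (1 + C) = 1 / (1 + C)" using C by (simp add: field_simps)
  finally show ?thesis using False by simp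
qed (simp add: stop_mass_def stop_prob_0[OF C])

text \<open>
  The power counts the failed rounds: the test is passed with probability \<open>C / (1 + C)\<close> and the coin
  then shows \<open>0\<close>.
\<close>

fun logistic_mass :: "real \<Rightarrow> real \<Rightarrow> bool \<times> nat \<Rightarrow> real" where
  "logistic_mass p C (False, n) = 1 / (1 + C) * (C / (1 + C) * (1 - p)) ^ n"
| "logistic_mass p C (True, 0) = 0"
| "logistic_mass p C (True, Suc n) = C / (1 + C) * p * (C / (1 + C) * (1 - p)) ^ n"

lemma logistic_mass_nonneg: "0 < C \<Longrightarrow> 0 \<le> p \<Longrightarrow> p \<le> 1 \<Longrightarrow> 0 \<le> logistic_mass p C y"
  by (cases "(p, C, y)" rule: logistic_mass.cases) auto

lemma stop_mass_eq:
  assumes C: "0 < C" and p: "0 \<le> p" "p \<le> 1"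
  shows "stop_mass p C (b, n) = ennreal (logistic_mass p C (b, n))"
proof (induction n)
  case 0
  show ?case by (cases b) (simp_all add: stop_mass_0[OF C])
next
  case (Suc n)
  have *: "logistic_mass p C (b, Suc n) = C / (1 + C) * (p * of_bool (b \<and> n = 0) + (1 - p) * logistic_mass p C (b, n))"
    by (cases b; cases n) (simp_all add: field_simps)
  show ?case
    unfolding stop_mass_Suc[OF assms] Suc.IH *
    using C p logistic_mass_nonneg[OF assms, of "(b, n)"]
    by (simp add: ennreal_mult del: times_divide_eq_left times_divide_eq_right)
qed

lemma measure_logistic_space:
  assumes C: "0 < C" and p: "0 \<le> p" "p \<le> 1"
  shows "measure (logistic_space p C)
     {\<omega> \<in> space (logistic_space p C). case \<omega> of (A, T\<^sub>0, w) \<Rightarrow> logistic_run A T\<^sub>0 w = Some y} =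
    logistic_mass p C y"
proof -
  interpret S: prob_space "flip_stream p C" by (rule prob_space_flip_stream[OF C])
  interpret E: prob_space "exp_dist C" by (rule prob_space_exp_dist[OF C])
  interpret ES: prob_space "exp_dist C \<Otimes>\<^sub>M flip_stream p C"
    by (intro prob_space_pair S.prob_space_axioms E.prob_space_axioms)
  let ?X = "{\<omega> \<in> space (logistic_space p C). case \<omega> of (A, T\<^sub>0, w) \<Rightarrow> logistic_run A T\<^sub>0 w = Some y}"
  let ?f = "\<lambda>x. indicator {w. logistic_run (fst x) (fst (snd x)) w = Some y} (snd (snd x)) :: ennreal"
  have sets: "sets (logistic_space p C) = sets (borel \<Otimes>\<^sub>M borel \<Otimes>\<^sub>M flip_stream p C)"
    unfolding logistic_space_def by (intro sets_pair_measure_cong) auto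
  have f [measurable]: "?f \<in> borel_measurable (exp_dist 1 \<Otimes>\<^sub>M (exp_dist C \<Otimes>\<^sub>M flip_stream p C))"
    using measurable_logistic_run_indicator[of y p C] sets
    by (subst measurable_cong_sets[OF _ refl]) (auto simp: logistic_space_def)
  have X: "?X \<in> sets (logistic_space p C)"
  proof -
    have "?f -` {1} \<inter> space (logistic_space p C) \<in> sets (logistic_space p C)"
      using f unfolding logistic_space_def by (rule measurable_sets) simp
    also have "?f -` {1} \<inter> space (logistic_space p C) = ?X"
      by (auto simp: indicator_def split: if_splits)
    finally show ?thesis .
  qed
  have "emeasure (logistic_space p C) ?X = (\<integral>\<^sup>+ x. indicator ?X x \<partial>logistic_space p C)"
    using X by simp
  also have "\<dots> = (\<integral>\<^sup>+ x. ?f x \<partial>logistic_space p C)"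
    by (intro nn_integral_cong) (auto simp: indicator_def)
  also have "\<dots> = (\<integral>\<^sup>+ a. (\<integral>\<^sup>+ x. ?f (a, x) \<partial>(exp_dist C \<Otimes>\<^sub>M flip_stream p C)) \<partial>exp_dist 1)"
    unfolding logistic_space_def by (subst ES.nn_integral_fst[symmetric]) (simp_all add: f)
  also have "\<dots> = (\<integral>\<^sup>+ a. (\<integral>\<^sup>+ t. (\<integral>\<^sup>+ w. ?f (a, t, w) \<partial>flip_stream p C) \<partial>exp_dist C) \<partial>exp_dist 1)"
  proof (intro nn_integral_cong)
    fix a
    have "(\<lambda>x. ?f (a, x)) \<in> borel_measurable (exp_dist C \<Otimes>\<^sub>M flip_stream p C)"
      by (rule measurable_compose[OF _ f]) simp
    from S.nn_integral_fst[OF this]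
    show "(\<integral>\<^sup>+ x. ?f (a, x) \<partial>(exp_dist C \<Otimes>\<^sub>M flip_stream p C)) =
        (\<integral>\<^sup>+ t. (\<integral>\<^sup>+ w. ?f (a, t, w) \<partial>flip_stream p C) \<partial>exp_dist C)" by simp
  qed
  also have "\<dots> = stop_mass p C y"
    by (simp only: stop_mass_def stop_prob_def fst_conv snd_conv)
  also have "\<dots> = ennreal (logistic_mass p C y)"
    using stop_mass_eq[OF assms, of "fst y" "snd y"] by simp
  finally show ?thesis
    using logistic_mass_nonneg[OF assms, of y] by (simp add: measure_def)
qed

lemma nn_integral_logistic_mass:
  "(\<integral>\<^sup>+ y. ennreal (logistic_mass p C y) * h y \<partial>count_space UNIV) =
   (\<Sum>n. ennreal (C / (1 + C) * p * (C / (1 + C) * (1 - p)) ^ n) * h (True, Suc n)) +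
   (\<Sum>n. ennreal (1 / (1 + C) * (C / (1 + C) * (1 - p)) ^ n) * h (False, n))"
proof -
  let ?f = "\<lambda>y. ennreal (logistic_mass p C y) * h y"
  have "(\<integral>\<^sup>+ y. ?f y \<partial>count_space UNIV) =
      (\<integral>\<^sup>+ b. (\<integral>\<^sup>+ n. ?f (b, n) \<partial>count_space UNIV) \<partial>count_space UNIV)"
    by (rule nn_integral_fst_count_space[symmetric])
  also have "\<dots> = (\<Sum>b\<in>UNIV. \<Sum>n. ?f (b, n))"
    by (subst nn_integral_count_space_finite) (auto simp: nn_integral_count_space_nat)
  also have "\<dots> = (\<Sum>n. ?f (True, n)) + (\<Sum>n. ?f (False, n))"
    by (simp add: UNIV_bool add.commute)
  also have "(\<Sum>n. ?f (True, n)) = (\<Sum>n. ?f (True, n + 1)) + (\<Sum>n<1. ?f (True, n))"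
    by (rule suminf_offset) simp
  finally show ?thesis by simp
qed

context
  fixes p C a g :: real
  assumes C: "0 < C" and p: "0 \<le> p" "p \<le> 1"
  defines "a \<equiv> C / (1 + C)" and "g \<equiv> C / (1 + C) * (1 - p)"
begin

private lemma g_bounds: "0 \<le> g" "g < 1"
proof -
  have "g \<le> C / (1 + C) * 1"
    unfolding g_def using C p by (intro mult_left_mono) auto
  also have "\<dots> < 1" using C by simp
  finally show "g < 1" .
  show "0 \<le> g" using C p by (simp add: g_def)
qed

private lemma one_minus_g: "1 - g = (1 + C * p) / (1 + C)"
  using C by (simp add: g_def field_simps)

private lemma suminf_geometric_ennreal:
  assumes "0 \<le> c"
  shows "(\<Sum>n. ennreal (c * g ^ n)) = ennreal (c / (1 - g))"
proof (rule suminf_ennreal_eq)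
  show "(\<lambda>n. c * g ^ n) sums (c / (1 - g))"
    using sums_mult[OF geometric_sums[of g], of c] g_bounds by simp
qed (use assms g_bounds in auto)

private lemma True_mass:
  "(\<Sum>n. ennreal (a * p * g ^ n)) = ennreal (C * p / (1 + C * p))"
proof -
  have "1 + C * p > 0" using C p by (simp add: add_pos_nonneg)
  then have "a * p / (1 - g) = C * p / (1 + C * p)"
    unfolding one_minus_g using C by (simp add: a_def)
  then show ?thesis
    using C p by (subst suminf_geometric_ennreal) (auto simp: a_def)
qed

private lemma False_mass:
  "(\<Sum>n. ennreal (1 / (1 + C) * g ^ n)) = ennreal (1 / (1 + C * p))"
proof -
  have "1 + C * p > 0" using C p by (simp add: add_pos_nonneg)
  then have "1 / (1 + C) / (1 - g) = 1 / (1 + C * p)"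
    unfolding one_minus_g using C by simp
  then show ?thesis
    using C p by (subst suminf_geometric_ennreal) auto
qed

lemma spmf_logistic_bf: "spmf (logistic_bf p C) y = logistic_mass p C y"
proof -
  have pos: "1 + C * p > 0" using C p by (simp add: add_pos_nonneg)
  have "(\<integral>\<^sup>+ y. ennreal (logistic_mass p C y) \<partial>count_space UNIV) = 1"
  proof -
    have "(\<integral>\<^sup>+ y. ennreal (logistic_mass p C y) \<partial>count_space UNIV) =
        (\<Sum>n. ennreal (a * p * g ^ n)) + (\<Sum>n. ennreal (1 / (1 + C) * g ^ n))"
      using nn_integral_logistic_mass[of p C "\<lambda>_. 1"] by (simp only: a_def g_def mult_1_right)
    also have "\<dots> = ennreal (C * p / (1 + C * p) + 1 / (1 + C * p))"
      unfolding True_mass False_mass using C p by (subst ennreal_plus) auto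
    also have "C * p / (1 + C * p) + 1 / (1 + C * p) = 1"
      using pos by (simp add: add_divide_distrib[symmetric] add.commute)
    finally show ?thesis by simp
  qed
  then show ?thesis
    unfolding logistic_bf_def measure_logistic_space[OF C p]
    using logistic_mass_nonneg[OF C p, of y] by (subst spmf_embed_spmf) auto
qed

lemma nn_integral_logistic_bf:
  "(\<integral>\<^sup>+ y. h y \<partial>measure_spmf (logistic_bf p C)) =
   (\<Sum>n. ennreal (a * p * g ^ n) * h (True, Suc n)) + (\<Sum>n. ennreal (1 / (1 + C) * g ^ n) * h (False, n))"
  unfolding nn_integral_measure_spmf spmf_logistic_bf nn_integral_logistic_mass a_def g_def ..

lemma prob_logistic_bf_True: "spmf (map_spmf fst (logistic_bf p C)) True = C * p / (1 + C * p)"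
proof -
  have "ennreal (spmf (map_spmf fst (logistic_bf p C)) True) = ennreal (C * p / (1 + C * p))"
    using True_mass by (simp add: ennreal_spmf_map_conv_nn_integral nn_integral_logistic_bf del: nn_integral_indicator)
  then show ?thesis using C p by simp
qed

lemma prob_logistic_bf_False: "spmf (map_spmf fst (logistic_bf p C)) False = 1 / (1 + C * p)"
proof -
  have "ennreal (spmf (map_spmf fst (logistic_bf p C)) False) = ennreal (1 / (1 + C * p))"
    using False_mass by (simp add: ennreal_spmf_map_conv_nn_integral nn_integral_logistic_bf del: nn_integral_indicator)
  then show ?thesis using C p by simp
qed

lemma expected_flips_logistic_bf: "expected_flips (logistic_bf p C) = ennreal (C / (1 + C * p))"
proof -
  have pos: "1 + C * p > 0" using C p by (simp add: add_pos_nonneg)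
  have deriv: "(\<lambda>n. of_nat (Suc n) * g ^ n) sums (1 / (1 - g)\<^sup>2)"
    using geometric_deriv_sums[of g] g_bounds by simp
  have 1: "(\<Sum>n. ennreal (a * p * g ^ n) * of_nat (Suc n)) = ennreal (a * p / (1 - g)\<^sup>2)"
  proof -
    have "(\<lambda>n. a * p * (of_nat (Suc n) * g ^ n)) sums (a * p * (1 / (1 - g)\<^sup>2))"
      by (rule sums_mult[OF deriv])
    then have "(\<Sum>n. ennreal (a * p * (of_nat (Suc n) * g ^ n))) = ennreal (a * p * (1 / (1 - g)\<^sup>2))"
      using C p g_bounds by (intro suminf_ennreal_eq) (auto simp: a_def)
    moreover have "ennreal (a * p * (of_nat (Suc n) * g ^ n)) = ennreal (a * p * g ^ n) * of_nat (Suc n)" for n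
      using C p g_bounds
      by (subst ennreal_of_nat_eq_real_of_nat, subst ennreal_mult[symmetric]) (auto simp: a_def ac_simps)
    ultimately show ?thesis by simp
  qed
  have 2: "(\<Sum>n. ennreal (1 / (1 + C) * g ^ n) * of_nat n) = ennreal (1 / (1 + C) * g / (1 - g)\<^sup>2)"
  proof -
    have "(\<lambda>n. 1 / (1 + C) * g * (of_nat (Suc n) * g ^ n)) sums (1 / (1 + C) * g * (1 / (1 - g)\<^sup>2))"
      by (rule sums_mult[OF deriv])
    then have "(\<lambda>n. 1 / (1 + C) * (of_nat (Suc n) * g ^ Suc n)) sums (1 / (1 + C) * g * (1 / (1 - g)\<^sup>2))"
      by (simp add: ac_simps)
    then have "(\<lambda>n. 1 / (1 + C) * (of_nat n * g ^ n)) sums (1 / (1 + C) * g * (1 / (1 - g)\<^sup>2))"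
      by (subst (asm) sums_Suc_iff) simp
    then have "(\<Sum>n. ennreal (1 / (1 + C) * (of_nat n * g ^ n))) = ennreal (1 / (1 + C) * g * (1 / (1 - g)\<^sup>2))"
      using C p g_bounds by (intro suminf_ennreal_eq) auto
    moreover have "ennreal (1 / (1 + C) * (of_nat n * g ^ n)) = ennreal (1 / (1 + C) * g ^ n) * of_nat n" for n
      using C p g_bounds
      by (subst ennreal_of_nat_eq_real_of_nat, subst ennreal_mult[symmetric]) (auto simp: ac_simps)
    ultimately show ?thesis by simp
  qed
  have "a * p + 1 / (1 + C) * g = a * (1 - g)"
  proof -
    have "1 / (1 + C) = 1 - a" "g = a * (1 - p)" using C by (simp_all add: a_def g_def field_simps)
    then have "a * p + 1 / (1 + C) * g = a * p + (1 - a) * (a * (1 - p))" "a * (1 - g) = a * (1 - a * (1 - p))"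
      by simp_all
    then show ?thesis by (simp add: algebra_simps)
  qed
  then have sum: "a * p / (1 - g)\<^sup>2 + 1 / (1 + C) * g / (1 - g)\<^sup>2 = a / (1 - g)"
    using g_bounds unfolding add_divide_distrib[symmetric] by (simp add: power2_eq_square)
  also have "\<dots> = C / (1 + C * p)"
    unfolding one_minus_g using C pos by (simp add: a_def)
  finally have "ennreal (C / (1 + C * p)) = ennreal (a * p / (1 - g)\<^sup>2 + 1 / (1 + C) * g / (1 - g)\<^sup>2)"
    by simp
  also have "\<dots> = ennreal (a * p / (1 - g)\<^sup>2) + ennreal (1 / (1 + C) * g / (1 - g)\<^sup>2)"
    using C p g_bounds by (intro ennreal_plus) (auto simp: a_def)
  finally show ?thesis
    unfolding expected_flips_def nn_integral_logistic_bf snd_conv 1 2 by simp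
qed

end

section \<open>Output probabilities and flips of sequential programs\<close>

definition out_prob :: "(bool \<times> nat) spmf \<Rightarrow> bool \<Rightarrow> real" where
  "out_prob P b = spmf (map_spmf fst P) b"

lemma out_prob_nonneg [simp]: "0 \<le> out_prob P b"
  by (simp add: out_prob_def)

lemma out_prob_None [simp]: "out_prob (return_pmf None) b = 0"
  by (simp add: out_prob_def)

lemma out_prob_return [simp]: "out_prob (return_spmf (x, n)) b = of_bool (x = b)"
  by (simp add: out_prob_def)

lemma weight_eq_out_prob: "1 - pmf P None = out_prob P True + out_prob P False"
proof -
  have "ennreal (weight_spmf P) = ennreal (weight_spmf (map_spmf fst P))" by simp
  also have "\<dots> = (\<integral>\<^sup>+ b. spmf (map_spmf fst P) b \<partial>count_space UNIV)"
    unfolding weight_spmf_eq_nn_integral_spmf ..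
  also have "\<dots> = ennreal (out_prob P True + out_prob P False)"
    by (subst nn_integral_count_space_finite) (auto simp: UNIV_bool out_prob_def add.commute)
  finally have "weight_spmf P = out_prob P True + out_prob P False"
    by (subst (asm) ennreal_inj) auto
  then show ?thesis
    by (simp add: pmf_None_eq_weight_spmf)
qed

text \<open>
  For quantities that depend only on the output bit, a program is as good as a two-point measure.
\<close>

lemma nn_integral_by_output:
  fixes c :: "bool \<Rightarrow> ennreal"
  shows "(\<integral>\<^sup>+ y. c (fst y) \<partial>measure_spmf P) = ennreal (out_prob P True) * c True + ennreal (out_prob P False) * c False"
proof -
  have "(\<integral>\<^sup>+ y. c (fst y) \<partial>measure_spmf P) = (\<integral>\<^sup>+ b. c b \<partial>measure_spmf (map_spmf fst P))"
    by (simp add: nn_integral_map_spmf comp_def)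
  also have "\<dots> = (\<integral>\<^sup>+ b. ennreal (spmf (map_spmf fst P) b) * c b \<partial>count_space UNIV)"
    by (rule nn_integral_measure_spmf)
  also have "\<dots> = ennreal (out_prob P True) * c True + ennreal (out_prob P False) * c False"
    by (subst nn_integral_count_space_finite) (auto simp: UNIV_bool out_prob_def add.commute)
  finally show ?thesis .
qed

lemma nn_integral_bind_spmf:
  "(\<integral>\<^sup>+ y. f y \<partial>measure_spmf (bind_spmf P G)) = (\<integral>\<^sup>+ x. (\<integral>\<^sup>+ y. f y \<partial>measure_spmf (G x)) \<partial>measure_spmf P)"
  unfolding measure_spmf_bind
  by (subst nn_integral_bind[where B = "count_space UNIV"])
     (auto simp: space_subprob_algebra subprob_space_measure_spmf)

text \<open>
  Every algorithm at hand is built from this pattern: the continuation sees only the output bit, and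
  flips add up.
\<close>

definition seq :: "(bool \<times> nat) spmf \<Rightarrow> (bool \<Rightarrow> (bool \<times> nat) spmf) \<Rightarrow> (bool \<times> nat) spmf" where
  "seq P G = do { (b, k) \<leftarrow> P; (x, l) \<leftarrow> G b; return_spmf (x, k + l) }"

lemma map_fst_seq: "map_spmf fst (seq P G) = bind_spmf (map_spmf fst P) (\<lambda>b. map_spmf fst (G b))"
  unfolding seq_def
  by (simp add: map_spmf_conv_bind_spmf case_prod_unfold)

lemma out_prob_seq:
  "out_prob (seq P G) x = out_prob P True * out_prob (G True) x + out_prob P False * out_prob (G False) x"
proof -
  have "ennreal (out_prob (seq P G) x) = (\<integral>\<^sup>+ b. ennreal (out_prob (G b) x) \<partial>measure_spmf (map_spmf fst P))"
    by (simp add: out_prob_def map_fst_seq ennreal_spmf_bind)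
  also have "\<dots> = ennreal (out_prob P True * out_prob (G True) x + out_prob P False * out_prob (G False) x)"
    using nn_integral_by_output[of P "\<lambda>b. ennreal (out_prob (G b) x)"]
    by (simp add: nn_integral_map_spmf comp_def ennreal_mult)
  finally show ?thesis by (subst (asm) ennreal_inj) auto
qed

lemma seq_return_left: "seq (return_spmf (b, 0)) G = G b"
proof -
  have "(\<lambda>(x, l). return_spmf (x, l)) = (return_spmf :: bool \<times> nat \<Rightarrow> _)" by auto
  then show ?thesis by (simp add: seq_def)
qed

lemma expected_flips_return [simp]: "expected_flips (return_spmf (x, n)) = of_nat n"
  by (simp add: expected_flips_def measure_spmf_return_spmf nn_integral_return)

lemma expected_flips_None [simp]: "expected_flips (return_pmf None) = 0"
  by (simp add: expected_flips_def)

text \<open>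
  Only an inequality, since the flips made by \<open>P\<close> are lost in the runs in which \<open>G\<close> diverges.
\<close>

lemma expected_flips_seq_le:
  "expected_flips (seq P G) \<le> expected_flips P +
    (ennreal (out_prob P True) * expected_flips (G True) + ennreal (out_prob P False) * expected_flips (G False))"
proof -
  have inner: "(\<integral>\<^sup>+ y. of_nat (snd y) \<partial>measure_spmf (bind_spmf (G b) (\<lambda>(x, l). return_spmf (x, k + l))))
      \<le> of_nat k + expected_flips (G b)" for b k
  proof -
    have "(\<integral>\<^sup>+ y. of_nat (snd y) \<partial>measure_spmf (bind_spmf (G b) (\<lambda>(x, l). return_spmf (x, k + l)))) =
        (\<integral>\<^sup>+ y. of_nat k + of_nat (snd y) \<partial>measure_spmf (G b))"
      unfolding nn_integral_bind_spmf
      by (intro nn_integral_cong) (auto simp: measure_spmf_return_spmf nn_integral_return)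
    also have "\<dots> = of_nat k * emeasure (measure_spmf (G b)) (space (measure_spmf (G b))) + expected_flips (G b)"
      by (subst nn_integral_add) (auto simp: expected_flips_def)
    also have "\<dots> \<le> of_nat k * 1 + expected_flips (G b)"
      by (intro add_right_mono mult_left_mono measure_spmf.subprob_emeasure_le_1) auto
    finally show ?thesis by simp
  qed
  have "expected_flips (seq P G) =
    (\<integral>\<^sup>+ y. (\<integral>\<^sup>+ z. of_nat (snd z) \<partial>measure_spmf (bind_spmf (G (fst y)) (\<lambda>(x, l). return_spmf (x, snd y + l)))) \<partial>measure_spmf P)"
    by (simp add: expected_flips_def seq_def nn_integral_bind_spmf case_prod_unfold)
  also have "\<dots> \<le> (\<integral>\<^sup>+ y. of_nat (snd y) + expected_flips (G (fst y)) \<partial>measure_spmf P)"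
    by (intro nn_integral_mono inner)
  also have "\<dots> = expected_flips P + (\<integral>\<^sup>+ y. expected_flips (G (fst y)) \<partial>measure_spmf P)"
    by (simp add: nn_integral_add expected_flips_def)
  finally show ?thesis by (simp only: nn_integral_by_output[where c = "\<lambda>b. expected_flips (G b)"])
qed

text \<open>
  Bounds for both output probabilities are needed: together they are closed under composition and
  under limits of chains, and for a lossless program they determine the output distribution.
\<close>

definition cost_bound :: "(bool \<times> nat) spmf \<Rightarrow> real \<Rightarrow> real \<Rightarrow> bool" where
  "cost_bound P q T \<longleftrightarrow> out_prob P True \<le> q \<and> out_prob P False \<le> 1 - q \<and> expected_flips P \<le> ennreal T"

lemma cost_bound_prob: "cost_bound P q T \<Longrightarrow> 0 \<le> q \<and> q \<le> 1"
  using out_prob_nonneg[of P True] out_prob_nonneg[of P False] unfolding cost_bound_def by linarith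

lemma cost_bound_mono: "cost_bound P q T \<Longrightarrow> T \<le> T' \<Longrightarrow> cost_bound P q T'"
  unfolding cost_bound_def by (auto intro: order_trans ennreal_leI)

lemma cost_bound_None: "0 \<le> q \<Longrightarrow> q \<le> 1 \<Longrightarrow> cost_bound (return_pmf None) q T"
  by (simp add: cost_bound_def)

lemma cost_bound_return: "0 \<le> T \<Longrightarrow> cost_bound (return_spmf (x, 0)) (of_bool x) T"
  by (simp add: cost_bound_def)

lemma cost_bound_seq:
  assumes P: "cost_bound P q T" and G: "\<And>b. cost_bound (G b) (h b) (U b)"
    and nonneg: "0 \<le> T" "\<And>b. 0 \<le> U b"
  shows "cost_bound (seq P G) (q * h True + (1 - q) * h False) (T + (q * U True + (1 - q) * U False))"
proof -
  have q: "out_prob P True \<le> q" "out_prob P False \<le> 1 - q" "expected_flips P \<le> ennreal T"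
    using P by (auto simp: cost_bound_def)
  have q01: "0 \<le> q" "q \<le> 1" using cost_bound_prob[OF P] by auto
  have h: "out_prob (G b) True \<le> h b" "out_prob (G b) False \<le> 1 - h b"
      "expected_flips (G b) \<le> ennreal (U b)" for b
    using G[of b] by (auto simp: cost_bound_def)
  have "out_prob (seq P G) True \<le> q * h True + (1 - q) * h False"
    unfolding out_prob_seq by (intro add_mono mult_mono q h) (use q01 in auto)
  moreover have "out_prob (seq P G) False \<le> q * (1 - h True) + (1 - q) * (1 - h False)"
    unfolding out_prob_seq by (intro add_mono mult_mono q h) (use q01 in auto)
  moreover have "expected_flips (seq P G) \<le> ennreal T + (ennreal q * ennreal (U True) + ennreal (1 - q) * ennreal (U False))"
    by (rule order_trans[OF expected_flips_seq_le]) (intro add_mono mult_mono q h ennreal_leI; simp)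
  moreover have "\<dots> = ennreal (T + (q * U True + (1 - q) * U False))"
    using q01 nonneg by (simp add: ennreal_mult)
  moreover have "q * (1 - h True) + (1 - q) * (1 - h False) = 1 - (q * h True + (1 - q) * h False)"
    by (simp add: algebra_simps)
  ultimately show ?thesis by (simp add: cost_bound_def)
qed

text \<open>
  A run of \<open>seq P G\<close> diverges either in \<open>P\<close> or in the continuation that belongs to its output.
\<close>

lemma loss_seq_le:
  assumes "cost_bound P q T"
  shows "pmf (seq P G) None \<le> pmf P None + (q * pmf (G True) None + (1 - q) * pmf (G False) None)"
proof -
  have eq: "pmf Q None = 1 - (out_prob Q True + out_prob Q False)" for Q
    using weight_eq_out_prob[of Q] by simp
  have "pmf (seq P G) None = pmf P None + (out_prob P True * pmf (G True) None + out_prob P False * pmf (G False) None)"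
    unfolding eq out_prob_seq by (simp add: algebra_simps)
  also have "\<dots> \<le> pmf P None + (q * pmf (G True) None + (1 - q) * pmf (G False) None)"
    using assms by (intro add_mono mult_right_mono order_refl) (auto simp: cost_bound_def)
  finally show ?thesis .
qed

text \<open>
  Monotone convergence along chains of subdistributions; countability of the outcomes allows chains
  that are not sequences.
\<close>

lemma mcont_nn_integral_spmf:
  fixes f :: "'a :: countable \<Rightarrow> ennreal"
  shows "mcont lub_spmf (ord_spmf (=)) Sup (\<le>) (\<lambda>P. \<integral>\<^sup>+ y. f y \<partial>measure_spmf P)"
proof (intro mcontI contI monotoneI)
  fix P Q :: "'a spmf" assume "ord_spmf (=) P Q"
  then show "(\<integral>\<^sup>+ y. f y \<partial>measure_spmf P) \<le> (\<integral>\<^sup>+ y. f y \<partial>measure_spmf Q)"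
    unfolding nn_integral_measure_spmf
    by (intro nn_integral_mono mult_right_mono ennreal_leI ord_spmf_eq_leD) auto
next
  fix Y :: "'a spmf set"
  assume chain: "Complete_Partial_Order.chain (ord_spmf (=)) Y" and Y: "Y \<noteq> {}"
  have "(\<integral>\<^sup>+ y. f y \<partial>measure_spmf (lub_spmf Y)) =
      (\<integral>\<^sup>+ y. (SUP P\<in>Y. ennreal (spmf P y) * f y) \<partial>count_space UNIV)"
    unfolding nn_integral_measure_spmf
    by (simp add: ennreal_spmf_lub_spmf[OF chain Y] SUP_mult_right_ennreal)
  also have "\<dots> = (SUP P\<in>Y. \<integral>\<^sup>+ y. ennreal (spmf P y) * f y \<partial>count_space UNIV)"
  proof (rule nn_integral_monotone_convergence_SUP_countable[OF Y])
    show "Complete_Partial_Order.chain (\<le>) ((\<lambda>P y. ennreal (spmf P y) * f y) ` Y)"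
      using chain by (rule chain_imageI)
        (auto simp: le_fun_def intro!: mult_right_mono ennreal_leI ord_spmf_eq_leD)
  qed auto
  finally show "(\<integral>\<^sup>+ y. f y \<partial>measure_spmf (lub_spmf Y)) = (SUP P\<in>Y. \<integral>\<^sup>+ y. f y \<partial>measure_spmf P)"
    by (simp only: nn_integral_measure_spmf)
qed

lemma admissible_nn_integral_le [cont_intro]:
  fixes f :: "'b :: countable \<Rightarrow> ennreal"
  assumes "mcont lub ord lub_spmf (ord_spmf (=)) P"
  shows "ccpo.admissible lub ord (\<lambda>x. (\<integral>\<^sup>+ y. f y \<partial>measure_spmf (P x)) \<le> c)"
proof (rule ccpo.admissibleI)
  fix Y assume chain: "Complete_Partial_Order.chain ord Y" and Y: "Y \<noteq> {}"
    and le: "\<forall>x\<in>Y. (\<integral>\<^sup>+ y. f y \<partial>measure_spmf (P x)) \<le> c"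
  have "(\<integral>\<^sup>+ y. f y \<partial>measure_spmf (P (lub Y))) = (SUP x\<in>Y. \<integral>\<^sup>+ y. f y \<partial>measure_spmf (P x))"
    by (rule mcont_contD[OF mcont2mcont[OF mcont_nn_integral_spmf assms] chain Y])
  then show "(\<integral>\<^sup>+ y. f y \<partial>measure_spmf (P (lub Y))) \<le> c"
    using le by (auto intro: SUP_least)
qed

text \<open>
  All three conditions bound an integral over the outcomes from above, hence pass to suprema of
  chains. This makes \<open>cost_bound\<close> accessible to fixed point induction.
\<close>

lemma admissible_cost_bound [cont_intro]:
  assumes "mcont lub ord lub_spmf (ord_spmf (=)) P"
  shows "ccpo.admissible lub ord (\<lambda>x. cost_bound (P x) q T)"
proof (cases "0 \<le> q \<and> q \<le> 1")
  case True
  have prob: "out_prob Q b \<le> z \<longleftrightarrow>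
      (\<integral>\<^sup>+ y. indicator (fst -` {b}) y \<partial>measure_spmf Q) \<le> ennreal z" if "0 \<le> z" for Q b z
    using that unfolding out_prob_def ennreal_spmf_map_conv_nn_integral[symmetric] by simp
  from True have "cost_bound Q q T \<longleftrightarrow>
      (\<integral>\<^sup>+ y. indicator (fst -` {True}) y \<partial>measure_spmf Q) \<le> ennreal q \<and>
      (\<integral>\<^sup>+ y. indicator (fst -` {False}) y \<partial>measure_spmf Q) \<le> ennreal (1 - q) \<and>
      (\<integral>\<^sup>+ y. of_nat (snd y) \<partial>measure_spmf Q) \<le> ennreal T" for Q
    unfolding cost_bound_def expected_flips_def by (simp only: prob diff_ge_0_iff_ge)
  then show ?thesis
    by (simp only:) (intro admissible_conj admissible_nn_integral_le assms)
next
  case False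
  then have "\<not> cost_bound Q q T" for Q using cost_bound_prob by blast
  then show ?thesis by (auto intro!: ccpo.admissibleI)
qed

section \<open>Truncated geometric sums and the rates of the recursion\<close>

definition geo_sum :: "real \<Rightarrow> nat \<Rightarrow> real" where
  "geo_sum x n = (\<Sum>i<n. x ^ i)"

definition geo_deriv_sum :: "real \<Rightarrow> nat \<Rightarrow> real" where
  "geo_deriv_sum x n = (\<Sum>i<n. real (Suc i) * x ^ i)"

lemma geo_sum_simps [simp]: "geo_sum x 0 = 0" "geo_sum x (Suc n) = geo_sum x n + x ^ n"
  by (simp_all add: geo_sum_def)

lemma geo_deriv_sum_simps [simp]:
  "geo_deriv_sum x 0 = 0" "geo_deriv_sum x (Suc n) = geo_deriv_sum x n + real (Suc n) * x ^ n"
  by (simp_all add: geo_deriv_sum_def)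

lemma geo_sum_nonneg: "0 \<le> x \<Longrightarrow> 0 \<le> geo_sum x n"
  by (induction n) auto

lemma geo_deriv_sum_nonneg: "0 \<le> x \<Longrightarrow> 0 \<le> geo_deriv_sum x n"
  by (induction n) auto

lemma geo_sum_Suc_shift: "geo_sum x (Suc n) = 1 + x * geo_sum x n"
proof (induction n)
  case (Suc n)
  have "geo_sum x (Suc (Suc n)) = 1 + x * geo_sum x n + x * x ^ n"
    unfolding Suc.IH[symmetric] by simp
  also have "\<dots> = 1 + x * geo_sum x (Suc n)" by (simp add: distrib_left)
  finally show ?case .
qed simp

lemma geo_sum_pos: "0 \<le> x \<Longrightarrow> 0 < n \<Longrightarrow> 0 < geo_sum x n"
  using geo_sum_Suc_shift[of x "n - 1"] geo_sum_nonneg[of x "n - 1"]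
  by (simp del: geo_sum_simps add: add_pos_nonneg)

lemma geo_sum_mono: "0 \<le> x \<Longrightarrow> m \<le> n \<Longrightarrow> geo_sum x m \<le> geo_sum x n"
  unfolding geo_sum_def by (intro sum_mono2) auto

text \<open>
  This says that \<open>\<lambda>s. geo_sum x s\<close> is harmonic for a walk with odds \<open>x : 1\<close> for going down.
\<close>

lemma geo_sum_three_term: "geo_sum x (Suc (Suc n)) + x * geo_sum x n = (1 + x) * geo_sum x (Suc n)"
  using geo_sum_Suc_shift[of x "Suc n"] geo_sum_Suc_shift[of x n]
  by (simp del: geo_sum_simps add: ring_distribs)

lemma geo_sum_ge: "0 \<le> x \<Longrightarrow> x \<le> 1 \<Longrightarrow> s \<le> n \<Longrightarrow> real s * x ^ n \<le> geo_sum x s"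
  using sum_mono[of "{..<s}" "\<lambda>_. x ^ n" "\<lambda>i. x ^ i"] by (simp add: power_decreasing geo_sum_def)

text \<open>
  The terms \<open>x ^ i\<close> decrease, so the average of the first \<open>s\<close> of them is at least the average of the first
  \<open>n\<close>.
\<close>

lemma geo_sum_concave:
  assumes "0 \<le> x" "x \<le> 1" "s \<le> n"
  shows "real s * geo_sum x n \<le> real n * geo_sum x s"
  using assms(3)
proof (induction n rule: dec_induct)
  case (step n)
  then show ?case using geo_sum_ge[OF assms(1,2), of s n] by (simp add: algebra_simps)
qed simp

lemma geo_deriv_sum_Suc_shift: "geo_deriv_sum x (Suc n) = geo_sum x (Suc n) + x * geo_deriv_sum x n"
proof (induction n)
  case (Suc n)
  have "geo_deriv_sum x (Suc (Suc n)) =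
      geo_sum x (Suc n) + x * geo_deriv_sum x n + real (Suc (Suc n)) * (x * x ^ n)"
    unfolding Suc.IH[symmetric] by simp
  also have "\<dots> = geo_sum x (Suc (Suc n)) + x * geo_deriv_sum x (Suc n)"
    by (simp add: algebra_simps)
  finally show ?case .
qed simp

lemma one_minus_mult_geo_sum: "(1 - x) * geo_sum x n = 1 - x ^ n"
  using geo_sum_Suc_shift[of x n] by (simp add: algebra_simps)

lemma one_minus_mult_geo_deriv_sum: "(1 - x) * geo_deriv_sum x n = geo_sum x n - real n * x ^ n"
  using geo_deriv_sum_Suc_shift[of x n] by (simp add: algebra_simps)

text \<open>
  Links the mean duration of the walk from state 1 (left-hand side, up to normalisation) to the
  mean number of recursive calls (the subtracted term on the right-hand side).
\<close>

lemma deficit_geo_sum: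
  "real (Suc n) - geo_sum x (Suc n) = (1 - x) * (real n * geo_sum x (Suc n) - x * geo_deriv_sum x n)"
proof (induction n)
  case (Suc n)
  have "real (Suc (Suc n)) - geo_sum x (Suc (Suc n)) =
      (real (Suc n) - geo_sum x (Suc n)) + (1 - x ^ Suc n)" by simp
  also have "\<dots> = (1 - x) * (real n * geo_sum x (Suc n) - x * geo_deriv_sum x n) + (1 - x) * geo_sum x (Suc n)"
    unfolding Suc.IH one_minus_mult_geo_sum ..
  also have "\<dots> = (1 - x) * (real (Suc n) * geo_sum x (Suc (Suc n)) - x * geo_deriv_sum x (Suc n))"
    by (simp add: algebra_simps)
  finally show ?case .
qed simp

text \<open>
  With \<open>x = \<rho>\<close> and \<open>n = m - 1\<close>: the mean number of calls of the linear factory that one such call makes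
  directly.
\<close>

definition recursion_rate :: "real \<Rightarrow> nat \<Rightarrow> real" where
  "recursion_rate x n = x * geo_deriv_sum x n / (real (Suc n) * geo_sum x (Suc n))"

lemma recursion_rate_nonneg: "0 \<le> x \<Longrightarrow> 0 \<le> recursion_rate x n"
  unfolding recursion_rate_def
  by (intro divide_nonneg_nonneg mult_nonneg_nonneg geo_deriv_sum_nonneg geo_sum_nonneg) auto

text \<open>
  Up to the factor \<open>n + 1\<close> the rate is the mean of a geometric distribution truncated to \<open>{0..n}\<close>; it is
  at most the mean \<open>x / (1 - x)\<close> of the full distribution.
\<close>

lemma recursion_rate_le:
  assumes "0 \<le> x" "x < 1"
  shows "recursion_rate x n \<le> x / (real (Suc n) * (1 - x))"
proof -
  have pos: "0 < geo_sum x (Suc n)" using assms by (intro geo_sum_pos) auto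
  have "(1 - x) * geo_deriv_sum x n \<le> geo_sum x (Suc n)"
    unfolding one_minus_mult_geo_deriv_sum using assms by (simp add: order_trans[of _ 0])
  then have "x * ((1 - x) * geo_deriv_sum x n) \<le> x * geo_sum x (Suc n)"
    using assms by (intro mult_left_mono) auto
  then have "x * geo_deriv_sum x n / geo_sum x (Suc n) \<le> x / (1 - x)"
    using assms pos by (subst divide_le_eq, simp) (simp add: field_simps)
  then have "x * geo_deriv_sum x n / geo_sum x (Suc n) / real (Suc n) \<le> x / (1 - x) / real (Suc n)"
    by (intro divide_right_mono) auto
  then show ?thesis by (simp only: recursion_rate_def divide_divide_eq_left mult.commute[of "real (Suc n)"])
qed

text \<open>
  The success probability of algorithm B when its counter is \<open>m = k + 1\<close>. For \<open>k = 0\<close> the value is \<open>0\<close>,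
  by division by zero, and the recursion below covers that case too.
\<close>

definition power_prob :: "real \<Rightarrow> nat \<Rightarrow> real" where
  "power_prob \<rho> k = real k * \<rho> ^ k / geo_sum \<rho> k"

text \<open>
  The mean number of iterations of algorithm B when its counter is \<open>m = k + 1\<close>.
\<close>

definition loop_rate :: "real \<Rightarrow> nat \<Rightarrow> real" where
  "loop_rate \<rho> k = geo_deriv_sum \<rho> k / geo_sum \<rho> k"

text \<open>
  The success probability of the high power factory called with parameter \<open>k - 1\<close>.
\<close>

definition hit_prob :: "real \<Rightarrow> nat \<Rightarrow> real" where
  "hit_prob \<rho> k = \<rho> ^ (k - 1) / geo_sum \<rho> k"

lemma loop_rate_nonneg: "0 \<le> \<rho> \<Longrightarrow> 0 \<le> loop_rate \<rho> k"
  by (simp add: loop_rate_def geo_deriv_sum_nonneg geo_sum_nonneg)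

lemma one_minus_hit_prob:
  assumes "0 \<le> \<rho>"
  shows "1 - hit_prob \<rho> (Suc k) = geo_sum \<rho> k / geo_sum \<rho> (Suc k)"
  using geo_sum_pos[OF assms, of "Suc k"] by (simp add: hit_prob_def field_simps)

lemma geo_sum_cancel:
  "0 \<le> \<rho> \<Longrightarrow> (k = 0 \<Longrightarrow> c = 0) \<Longrightarrow> geo_sum \<rho> k * (c / geo_sum \<rho> k) = c"
  using geo_sum_pos[of \<rho> k] by (cases "k = 0") auto

text \<open>
  One iteration of algorithm B: the inner call succeeds with probability \<open>\<rho>\<close>, and then either the high
  power factory or the rest of the loop has to.
\<close>

lemma power_prob_Suc:
  assumes "0 \<le> \<rho>"
  shows "power_prob \<rho> (Suc k) =
    \<rho> * (hit_prob \<rho> (Suc k) + (1 - hit_prob \<rho> (Suc k)) * power_prob \<rho> k)"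
proof -
  have "geo_sum \<rho> k * power_prob \<rho> k = real k * \<rho> ^ k"
    unfolding power_prob_def by (rule geo_sum_cancel[OF assms]) simp
  then have "hit_prob \<rho> (Suc k) + (1 - hit_prob \<rho> (Suc k)) * power_prob \<rho> k = real (Suc k) * \<rho> ^ k / geo_sum \<rho> (Suc k)"
    unfolding one_minus_hit_prob[OF assms]
    by (simp add: hit_prob_def add_divide_distrib[symmetric] distrib_right del: geo_sum_simps)
  then show ?thesis by (simp add: power_prob_def del: geo_sum_simps)
qed

lemma loop_rate_Suc:
  assumes "0 \<le> \<rho>"
  shows "loop_rate \<rho> (Suc k) = 1 + \<rho> * ((1 - hit_prob \<rho> (Suc k)) * loop_rate \<rho> k)"
proof -
  have pos: "0 < geo_sum \<rho> (Suc k)" using assms by (intro geo_sum_pos) auto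
  have "geo_sum \<rho> k * loop_rate \<rho> k = geo_deriv_sum \<rho> k"
    unfolding loop_rate_def by (rule geo_sum_cancel[OF assms]) simp
  then have "(1 - hit_prob \<rho> (Suc k)) * loop_rate \<rho> k = geo_deriv_sum \<rho> k / geo_sum \<rho> (Suc k)"
    unfolding one_minus_hit_prob[OF assms] by simp
  then show ?thesis
    using pos unfolding loop_rate_def geo_deriv_sum_Suc_shift
    by (simp add: add_divide_distrib del: geo_sum_simps)
qed

text \<open>
  The left-hand side multiplies the probability \<open>x * S n / S (n + 1)\<close> that walk A succeeds, the probability
  \<open>1 / (n + 1)\<close> of not accepting this success at once, and the mean number of iterations that follow.
\<close>

lemma ruin_times_loop_rate:
  assumes "0 < geo_sum x n"
  shows "x * geo_sum x n / geo_sum x (Suc n) * (1 / real (Suc n) * (loop_rate x n * W)) = recursion_rate x n * W"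
  using assms by (simp add: loop_rate_def recursion_rate_def mult_ac del: geo_sum_simps of_nat_Suc)

lemma ruin_times_power_prob:
  assumes "0 \<le> x" "0 < n"
  shows "x * geo_sum x n / geo_sum x (Suc n) * (real n / real (Suc n) + 1 / real (Suc n) * power_prob x n) =
    x * (real n / real (Suc n))"
proof -
  have pos: "0 < geo_sum x n" "0 < geo_sum x (Suc n)"
    using assms by (auto intro!: geo_sum_pos simp del: geo_sum_simps)
  have "geo_sum x n * (real n / real (Suc n) + 1 / real (Suc n) * power_prob x n) =
      real n / real (Suc n) * (geo_sum x n + x ^ n)"
    using pos by (simp add: power_prob_def distrib_left del: of_nat_Suc)
  then have "x * geo_sum x n / geo_sum x (Suc n) * (real n / real (Suc n) + 1 / real (Suc n) * power_prob x n) =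
      x * (real n / real (Suc n) * geo_sum x (Suc n)) / geo_sum x (Suc n)"
    by (simp add: mult.assoc del: of_nat_Suc)
  then show ?thesis using pos by (simp del: geo_sum_simps of_nat_Suc)
qed

section \<open>The random walks\<close>

lemma out_prob_logistic_bf:
  assumes "0 < C" "0 \<le> p" "p \<le> 1"
  shows "out_prob (logistic_bf p C) True = C * p / (1 + C * p)"
    "out_prob (logistic_bf p C) False = 1 / (1 + C * p)"
  unfolding out_prob_def using prob_logistic_bf_True prob_logistic_bf_False assms by auto

lemma cost_bound_logistic_bf:
  assumes "0 < C" "0 \<le> p" "p \<le> 1"
  shows "cost_bound (logistic_bf p C) (C * p / (1 + C * p)) (C / (1 + C * p))"
proof -
  have "1 + C * p > 0" using assms by (simp add: add_pos_nonneg)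
  then have "1 / (1 + C * p) = 1 - C * p / (1 + C * p)" by (simp add: field_simps)
  then show ?thesis
    using assms by (simp add: cost_bound_def out_prob_logistic_bf expected_flips_logistic_bf)
qed

lemma logistic_bf_lossless:
  assumes "0 < C" "0 \<le> p" "p \<le> 1"
  shows "pmf (logistic_bf p C) None = 0"
proof -
  have "1 + C * p > 0" using assms by (simp add: add_pos_nonneg)
  then have "C * p / (1 + C * p) + 1 / (1 + C * p) = 1" by (simp add: field_simps)
  then show ?thesis
    using weight_eq_out_prob[of "logistic_bf p C"] assms by (simp add: out_prob_logistic_bf)
qed

text \<open>
  The probability of absorption at \<open>0\<close> rather than \<open>M\<close>, from \<open>s\<close>, when the odds for going down are
  \<open>\<rho> : 1\<close>; for \<open>\<rho> \<noteq> 1\<close> it is \<open>(\<rho> ^ s - \<rho> ^ M) / (1 - \<rho> ^ M)\<close>.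
\<close>

definition ruin_prob :: "real \<Rightarrow> nat \<Rightarrow> nat \<Rightarrow> real" where
  "ruin_prob \<rho> M s = \<rho> ^ s * geo_sum \<rho> (M - s) / geo_sum \<rho> M"

text \<open>
  The mean number of coin flips until absorption when a step costs \<open>C / (1 + \<rho>)\<close>. By Wald's identity
  the mean number of steps is the expected displacement divided by the drift \<open>(1 - \<rho>) / (1 + \<rho>)\<close> per
  step.
\<close>

definition ruin_cost :: "real \<Rightarrow> real \<Rightarrow> nat \<Rightarrow> nat \<Rightarrow> real" where
  "ruin_cost C \<rho> M s = C * (real M * geo_sum \<rho> s / geo_sum \<rho> M - real s) / (1 - \<rho>)"

lemma ruin_prob_harmonic:
  assumes "0 \<le> \<rho>" "Suc s < M"
  shows "ruin_prob \<rho> M (Suc s) =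
    \<rho> / (1 + \<rho>) * ruin_prob \<rho> M s + (1 - \<rho> / (1 + \<rho>)) * ruin_prob \<rho> M (Suc (Suc s))"
proof -
  define k where "k = M - Suc (Suc s)"
  then have M: "M = Suc (Suc s) + k" using assms by simp
  have q: "1 - \<rho> / (1 + \<rho>) = 1 / (1 + \<rho>)" using assms by (simp add: field_simps)
  have "(1 + \<rho>) * (\<rho> ^ Suc s * geo_sum \<rho> (Suc k)) =
      \<rho> ^ Suc s * (geo_sum \<rho> (Suc (Suc k)) + \<rho> * geo_sum \<rho> k)"
    unfolding geo_sum_three_term by simp
  also have "\<dots> = \<rho> * (\<rho> ^ s * geo_sum \<rho> (Suc (Suc k))) + \<rho> ^ Suc (Suc s) * geo_sum \<rho> k"
    by (simp add: distrib_left mult_ac del: geo_sum_simps)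
  finally have "\<rho> ^ Suc s * geo_sum \<rho> (Suc k) =
      (\<rho> * (\<rho> ^ s * geo_sum \<rho> (Suc (Suc k))) + \<rho> ^ Suc (Suc s) * geo_sum \<rho> k) / (1 + \<rho>)"
    using assms by (simp add: eq_divide_eq mult.commute del: geo_sum_simps)
  then have "\<rho> ^ Suc s * geo_sum \<rho> (Suc k) / geo_sum \<rho> M =
      (\<rho> * (\<rho> ^ s * geo_sum \<rho> (Suc (Suc k))) + \<rho> ^ Suc (Suc s) * geo_sum \<rho> k) / (1 + \<rho>) / geo_sum \<rho> M"
    by simp
  moreover have "M - Suc s = Suc k" "M - s = Suc (Suc k)" "M - Suc (Suc s) = k" by (auto simp: M)
  ultimately show ?thesis
    unfolding ruin_prob_def q by (simp add: add_divide_distrib del: geo_sum_simps power_Suc)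
qed

lemma ruin_cost_harmonic:
  assumes "0 \<le> \<rho>" "\<rho> < 1"
  shows "ruin_cost C \<rho> M (Suc s) = C / (1 + \<rho>) +
    (\<rho> / (1 + \<rho>) * ruin_cost C \<rho> M s + (1 - \<rho> / (1 + \<rho>)) * ruin_cost C \<rho> M (Suc (Suc s)))"
proof -
  have q: "1 - \<rho> / (1 + \<rho>) = 1 / (1 + \<rho>)" using assms by (simp add: field_simps)
  define c where "c = real M / geo_sum \<rho> M"
  define X where "X s = c * geo_sum \<rho> s - real s" for s
  define \<kappa> where "\<kappa> = C / (1 - \<rho>)"
  have rc: "ruin_cost C \<rho> M s = \<kappa> * X s" for s
    by (simp add: ruin_cost_def c_def X_def \<kappa>_def)
  have \<kappa>: "\<kappa> * (1 - \<rho>) = C" using assms by (simp add: \<kappa>_def)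
  have "(1 + \<rho>) * X (Suc s) = c * ((1 + \<rho>) * geo_sum \<rho> (Suc s)) - (1 + \<rho>) * real (Suc s)"
    by (simp only: X_def right_diff_distrib mult.left_commute)
  also have "\<dots> = c * (geo_sum \<rho> (Suc (Suc s)) + \<rho> * geo_sum \<rho> s) - (1 + \<rho>) * real (Suc s)"
    by (simp only: geo_sum_three_term)
  also have "\<dots> = (1 - \<rho>) + \<rho> * X s + X (Suc (Suc s))"
    by (simp add: X_def algebra_simps del: geo_sum_simps)
  finally have "(1 + \<rho>) * (\<kappa> * X (Suc s)) = \<kappa> * (1 - \<rho>) + (\<rho> * (\<kappa> * X s) + \<kappa> * X (Suc (Suc s)))"
    by (simp only: mult.left_commute[of "1 + \<rho>"]) (simp add: algebra_simps)
  then have "(1 + \<rho>) * ruin_cost C \<rho> M (Suc s) = C + (\<rho> * ruin_cost C \<rho> M s + ruin_cost C \<rho> M (Suc (Suc s)))"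
    unfolding rc \<kappa> .
  then have "ruin_cost C \<rho> M (Suc s) = (C + (\<rho> * ruin_cost C \<rho> M s + ruin_cost C \<rho> M (Suc (Suc s)))) / (1 + \<rho>)"
    using assms by (simp add: eq_divide_eq mult.commute)
  then show ?thesis unfolding q by (simp add: add_divide_distrib)
qed

lemma ruin_cost_nonneg:
  assumes "0 \<le> C" "0 \<le> \<rho>" "\<rho> < 1" "s \<le> M" "0 < M"
  shows "0 \<le> ruin_cost C \<rho> M s"
proof -
  have "real s \<le> real M * geo_sum \<rho> s / geo_sum \<rho> M"
    using geo_sum_concave[of \<rho> s M] geo_sum_pos[of \<rho> M] assms by (simp add: pos_le_divide_eq)
  then show ?thesis using assms by (simp add: ruin_cost_def)
qed

context
  fixes p C \<rho> :: real and M :: nat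
  assumes C: "0 < C" and p: "0 \<le> p" "p \<le> 1" and rho: "\<rho> = C * p" "\<rho> < 1" and M: "0 < M"
begin

private lemma rho0: "0 \<le> \<rho>" using C p rho by simp

lemma walk_A_eq_seq:
  "Suc s < M \<Longrightarrow> walk_A p (int M) C (int (Suc s)) =
     seq (logistic_bf p C) (\<lambda>b. walk_A p (int M) C (int (if b then s else Suc (Suc s))))"
  by (subst walk_A.simps) (auto simp: seq_def intro!: bind_spmf_cong)

lemma walk_A_boundary:
  "walk_A p (int M) C 0 = return_spmf (True, 0)"
  "walk_A p (int M) C (int M) = return_spmf (False, 0)"
  using M by (subst walk_A.simps; simp)+

text \<open>
  Both \<open>ruin_prob\<close> and \<open>ruin_cost\<close> solve the one-step equations of the walk with the right boundary
  values, so the bound passes from one approximation of the fixed point to the next.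
\<close>

lemma cost_bound_walk_A:
  assumes "s \<le> M"
  shows "cost_bound (walk_A p (int M) C (int s)) (ruin_prob \<rho> M s) (ruin_cost C \<rho> M s)"
proof -
  have pos: "0 < geo_sum \<rho> M" using rho0 M by (rule geo_sum_pos)
  have prob_bounds: "0 \<le> ruin_prob \<rho> M s" "ruin_prob \<rho> M s \<le> 1" if "s \<le> M" for s
  proof -
    show "0 \<le> ruin_prob \<rho> M s"
      using rho0 by (simp add: ruin_prob_def geo_sum_nonneg)
    have "\<rho> ^ s * geo_sum \<rho> (M - s) \<le> 1 * geo_sum \<rho> M"
      using rho0 rho by (intro mult_mono geo_sum_mono geo_sum_nonneg power_le_one) auto
    then show "ruin_prob \<rho> M s \<le> 1" using pos by (simp add: ruin_prob_def)
  qed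
  have "\<forall>s\<le>M. cost_bound (walk_A p (int M) C (int s)) (ruin_prob \<rho> M s) (ruin_cost C \<rho> M s)"
  proof (induction rule: walk_A.fixp_induct)
    case 1
    show ?case unfolding curry_def by (intro admissible_all admissible_imp admissible_cost_bound mcont_call)
  next
    case 2
    show ?case using prob_bounds by (auto intro: cost_bound_None)
  next
    case (3 f)
    show ?case
    proof (intro allI impI)
      fix s assume s: "s \<le> M"
      let ?step = "\<lambda>c. if c \<in> {1..int M - 1}
          then bind_spmf (logistic_bf p C) (\<lambda>(b, k). bind_spmf (f p (int M) C (c - 2 * of_bool b + 1))
             (\<lambda>(x, l). return_spmf (x, k + l)))
          else return_spmf (c = 0, 0)"
      consider "s = 0" | "s = M" | s' where "s = Suc s'" "Suc s' < M"
        using s by (cases s) (auto simp: le_less)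
      then show "cost_bound (?step (int s)) (ruin_prob \<rho> M s) (ruin_cost C \<rho> M s)"
      proof cases
        case 1
        then have "ruin_prob \<rho> M s = of_bool True" "ruin_cost C \<rho> M s = 0"
          using pos by (simp_all add: ruin_prob_def ruin_cost_def)
        then show ?thesis using 1 cost_bound_return[of 0 True] by simp
      next
        case 2
        then have "ruin_prob \<rho> M s = of_bool False" "ruin_cost C \<rho> M s = 0"
          using pos by (simp_all add: ruin_prob_def ruin_cost_def)
        then show ?thesis using 2 M cost_bound_return[of 0 False] by simp
      next
        case 3
        have "?step (int s) = seq (logistic_bf p C) (\<lambda>b. f p (int M) C (int (if b then s' else Suc (Suc s'))))"
          using 3 by (auto simp: seq_def intro!: bind_spmf_cong)
        also have "cost_bound \<dots> (ruin_prob \<rho> M s) (ruin_cost C \<rho> M s)"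
        proof -
          let ?n = "\<lambda>b. if b then s' else Suc (Suc s')"
          have "cost_bound (seq (logistic_bf p C) (\<lambda>b. f p (int M) C (int (?n b))))
            (\<rho> / (1 + \<rho>) * ruin_prob \<rho> M (?n True) + (1 - \<rho> / (1 + \<rho>)) * ruin_prob \<rho> M (?n False))
            (C / (1 + \<rho>) + (\<rho> / (1 + \<rho>) * ruin_cost C \<rho> M (?n True) + (1 - \<rho> / (1 + \<rho>)) * ruin_cost C \<rho> M (?n False)))"
          proof (rule cost_bound_seq)
            show "cost_bound (logistic_bf p C) (\<rho> / (1 + \<rho>)) (C / (1 + \<rho>))"
              using cost_bound_logistic_bf[OF C p] rho by simp
            show "cost_bound (f p (int M) C (int (?n b))) (ruin_prob \<rho> M (?n b)) (ruin_cost C \<rho> M (?n b))" for b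
              using "3.IH" 3 by auto
            show "0 \<le> C / (1 + \<rho>)" using C rho0 by simp
            show "0 \<le> ruin_cost C \<rho> M (?n b)" for b
              using C rho0 rho M 3 by (intro ruin_cost_nonneg) auto
          qed
          then show ?thesis
            using 3 ruin_prob_harmonic[OF rho0, of s' M] ruin_cost_harmonic[OF rho0 rho(2), of C M s'] by simp
        qed
        finally show ?thesis .
      qed
    qed
  qed
  then show ?thesis using assms by blast
qed

text \<open>
  The probability \<open>d s\<close> of never being absorbed is subharmonic and vanishes at both ends. Its
  increments satisfy \<open>d (s + 2) - d (s + 1) \<ge> \<rho> * (d (s + 1) - d s)\<close>, so they are nonnegative from
  \<open>d 0 = 0\<close> on; then \<open>d s \<le> d M = 0\<close>.
\<close>

lemma walk_A_lossless:
  assumes "s \<le> M"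
  shows "pmf (walk_A p (int M) C (int s)) None = 0"
proof -
  define d where "d s = pmf (walk_A p (int M) C (int s)) None" for s
  have d0: "d 0 = 0" "d M = 0" using walk_A_boundary by (simp_all add: d_def)
  have sub: "d (Suc s) \<le> \<rho> / (1 + \<rho>) * d s + (1 - \<rho> / (1 + \<rho>)) * d (Suc (Suc s))" if "Suc s < M" for s
    using loss_seq_le[OF cost_bound_logistic_bf[OF C p], of "\<lambda>b. walk_A p (int M) C (int (if b then s else Suc (Suc s)))"]
      walk_A_eq_seq[OF that] rho by (simp add: d_def logistic_bf_lossless[OF C p])
  have incr: "d s \<le> d (Suc s)" if "s < M" for s
    using that
  proof (induction s)
    case 0
    show ?case using d0 by (simp add: d_def)
  next
    case (Suc s)
    have q: "1 - \<rho> / (1 + \<rho>) = 1 / (1 + \<rho>)" using rho0 by (simp add: field_simps)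
    have "d (Suc s) \<le> (\<rho> * d s + d (Suc (Suc s))) / (1 + \<rho>)"
      using sub[OF Suc.prems] unfolding q by (simp add: add_divide_distrib)
    then have "(1 + \<rho>) * d (Suc s) \<le> \<rho> * d s + d (Suc (Suc s))"
      using rho0 by (simp add: pos_le_divide_eq mult.commute)
    also have "\<rho> * d s \<le> \<rho> * d (Suc s)"
      using Suc rho0 by (intro mult_left_mono) auto
    finally show ?case by (simp add: algebra_simps)
  qed
  have "d s \<le> d M"
    using assms by (induction rule: inc_induct) (auto intro: order_trans incr)
  then have "d s \<le> 0" using d0 by simp
  then show ?thesis using d_def[of s] pmf_nonneg[of "walk_A p (int M) C (int s)" None] by linarith
qed

end

text \<open>
  The reflection \<open>s \<mapsto> m + 1 - s\<close> carries one walk into the other. Each side is a least fixed point,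
  which gives one inequality in the approximation order per direction.
\<close>

lemma walk_HP_eq_walk_A: "walk_HP p m \<beta> C s = walk_A p (m + 1) (\<beta> * C) (m + 1 - s)"
proof (rule spmf.leq_antisym)
  show "ord_spmf (=) (walk_HP p m \<beta> C s) (walk_A p (m + 1) (\<beta> * C) (m + 1 - s))"
  proof (induction arbitrary: s rule: walk_HP.fixp_induct)
    case 1
    show ?case by (simp add: curry_def)
  next
    case (3 f)
    have "ord_spmf (=) (f p m \<beta> C t \<bind> g) (walk_A p (m + 1) (\<beta> * C) (m + 1 - t) \<bind> g)"
      for t and g :: "bool \<times> nat \<Rightarrow> (bool \<times> nat) spmf"
      by (rule ord_spmf_bindI[OF 3]) (auto intro: ord_spmf_reflI)
    from this[of "s + 1"] this[of "s - 1"] show ?case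
      by (subst walk_A.simps) (auto simp: add.commute intro!: ord_spmf_bind_reflI)
  qed simp
  have "ord_spmf (=) (walk_A p (m + 1) (\<beta> * C) t) (walk_HP p m \<beta> C (m + 1 - t))" for t
  proof (induction arbitrary: t rule: walk_A.fixp_induct)
    case 1
    show ?case by (simp add: curry_def)
  next
    case (3 f)
    have "ord_spmf (=) (f p (m + 1) (\<beta> * C) u \<bind> g) (walk_HP p m \<beta> C (m + 1 - u) \<bind> g)"
      for u and g :: "bool \<times> nat \<Rightarrow> (bool \<times> nat) spmf"
      by (rule ord_spmf_bindI[OF 3]) (auto intro: ord_spmf_reflI)
    from this[of "t + 1"] this[of "t - 1"] show ?case
      by (subst walk_HP.simps) (auto simp: algebra_simps intro!: ord_spmf_bind_reflI)
  qed simp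
  from this[of "m + 1 - s"]
  show "ord_spmf (=) (walk_A p (m + 1) (\<beta> * C) (m + 1 - s)) (walk_HP p m \<beta> C s)" by simp
qed

section \<open>The parameters of one recursion level\<close>

definition walk_length :: "real \<Rightarrow> nat" where
  "walk_length \<epsilon> = nat \<lceil>4.5 / \<epsilon>\<rceil>"

definition inflation :: "real \<Rightarrow> real" where
  "inflation \<epsilon> = 1 + 1 / real (walk_length \<epsilon>)"

text \<open>
  The parameter \<open>\<epsilon>\<close> of the recursive call, that is, the gap between \<open>1\<close> and the bound
  \<open>(1 - \<epsilon>) \<beta>\<close> on the mean \<open>\<beta> C p\<close> of the output of that call.
\<close>

definition inner_gap :: "real \<Rightarrow> real" where
  "inner_gap \<epsilon> = 1 - (1 - \<epsilon>) * inflation \<epsilon>"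

locale factory_input =
  fixes p \<epsilon> C :: real
  assumes eps: "0 < \<epsilon>" "\<epsilon> < 1" and C: "0 < C" and p: "0 \<le> p" "p \<le> 1" and mean: "C * p \<le> 1 - \<epsilon>"
begin

abbreviation "n \<equiv> walk_length \<epsilon>"
abbreviation "\<beta> \<equiv> inflation \<epsilon>"
abbreviation "\<epsilon>' \<equiv> inner_gap \<epsilon>"
abbreviation "\<rho> \<equiv> \<beta> * C * p"

lemma ceiling_eq: "\<lceil>4.5 / \<epsilon>\<rceil> = int n"
proof -
  have "0 \<le> 4.5 / \<epsilon>" using eps by simp
  then have "0 \<le> \<lceil>4.5 / \<epsilon>\<rceil>" by linarith
  then show ?thesis by (simp add: walk_length_def)
qed

lemma walk_length_bounds: "4.5 \<le> real n * \<epsilon>" "(real n - 1) * \<epsilon> < 4.5"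
proof -
  have "real n = of_int \<lceil>4.5 / \<epsilon>\<rceil>" by (simp only: ceiling_eq of_int_of_nat_eq)
  then have "4.5 / \<epsilon> \<le> real n" "real n - 1 < 4.5 / \<epsilon>" by linarith+
  then show "4.5 \<le> real n * \<epsilon>" "(real n - 1) * \<epsilon> < 4.5"
    using eps by (simp_all add: pos_divide_le_eq pos_less_divide_eq)
qed

lemma n_gt: "4 < real n"
proof (rule ccontr)
  assume "\<not> 4 < real n"
  then have "real n * \<epsilon> \<le> 4 * 1" using eps by (intro mult_mono) auto
  then show False using walk_length_bounds by simp
qed

lemma beta: "1 < \<beta>" "real n * \<beta> = real (Suc n)"
  using n_gt by (auto simp: inflation_def field_simps)

lemma n_eps': "real n * \<epsilon>' = real n * \<epsilon> - (1 - \<epsilon>)"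
proof -
  have "real n * \<epsilon>' = real n - (1 - \<epsilon>) * (real n * \<beta>)" by (simp add: inner_gap_def algebra_simps)
  then show ?thesis unfolding beta(2) by (simp add: algebra_simps)
qed

lemma eps'_ge: "7 * \<epsilon> \<le> 9 * \<epsilon>'"
proof -
  have "9 * (real n * \<epsilon>') = 7 * (real n * \<epsilon>) + 2 * (real n * \<epsilon>) - 9 + 9 * \<epsilon>"
    unfolding n_eps' by simp
  also have "\<dots> \<ge> 7 * (real n * \<epsilon>)" using walk_length_bounds(1) eps by linarith
  finally have "real n * (7 * \<epsilon>) \<le> real n * (9 * \<epsilon>')" by simp
  then show ?thesis using n_gt by (subst (asm) mult_le_cancel_left_pos) auto
qed

lemma eps'_pos: "0 < \<epsilon>'" using eps'_ge eps by simp

lemma eps'_less_1: "\<epsilon>' < 1"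
  using eps beta by (simp add: inner_gap_def)

lemma rho: "0 \<le> \<rho>" "\<rho> \<le> 1 - \<epsilon>'" "\<rho> < 1"
proof -
  show "0 \<le> \<rho>" using C p beta by simp
  have "\<beta> * (C * p) \<le> \<beta> * (1 - \<epsilon>)" using mean beta by (intro mult_left_mono) auto
  then show "\<rho> \<le> 1 - \<epsilon>'" by (simp add: inner_gap_def mult.commute mult.left_commute)
  then show "\<rho> < 1" using eps'_pos by simp
qed

text \<open>
  In the bound \<open>\<rho> / ((n + 1) (1 - \<rho>))\<close> for the rate, \<open>\<rho>\<close> may be replaced by its largest possible value
  \<open>1 - \<epsilon>' = (1 - \<epsilon>) \<beta>\<close>. What remains is \<open>(1 - \<epsilon>) \<beta> / (n \<epsilon>')\<close>, and \<open>n \<epsilon>' \<ge> 3.5 + \<epsilon>\<close>.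
\<close>

lemma beta_recursion_rate_le: "\<beta> * recursion_rate \<rho> n \<le> 2 / 7 * (1 - \<epsilon>)"
proof -
  have "\<beta> * recursion_rate \<rho> n \<le> \<beta> * (\<rho> / (real (Suc n) * (1 - \<rho>)))"
    using rho beta by (intro mult_left_mono recursion_rate_le) auto
  also have "\<dots> = \<rho> / (1 - \<rho>) / real n"
    unfolding beta(2)[symmetric] using n_gt beta(1) rho(3) by (simp add: divide_simps)
  also have "\<dots> \<le> (1 - \<epsilon>') / \<epsilon>' / real n"
    using rho eps'_pos by (intro divide_right_mono frac_le) auto
  also have "\<dots> = (1 - \<epsilon>) * (\<beta> / (real n * \<epsilon>'))"
    using n_gt by (simp add: inner_gap_def mult.commute)
  also have "\<dots> \<le> (1 - \<epsilon>) * (2 / 7)"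
  proof (intro mult_left_mono)
    have "7 * (real n * \<beta>) \<le> real n * (2 * (real n * \<epsilon>'))"
    proof -
      have "7 * real n + 7 \<le> real n * 9 - real n * 2 + real n * 2 * \<epsilon>"
        using walk_length_bounds by simp
      also have "\<dots> = real n * (2 * (4.5 - (1 - \<epsilon>)))" by (simp add: algebra_simps)
      also have "\<dots> \<le> real n * (2 * (real n * \<epsilon>'))"
        unfolding n_eps' using walk_length_bounds by (intro mult_left_mono) auto
      finally show ?thesis unfolding beta(2) by simp
    qed
    then have "7 * \<beta> \<le> 2 * (real n * \<epsilon>')"
      using n_gt by (simp add: mult.left_commute[of 7])
    then show "\<beta> / (real n * \<epsilon>') \<le> 2 / 7"
      using n_gt eps'_pos by (simp add: field_simps)
  qed (use eps in auto)
  finally show ?thesis by (simp add: mult.commute)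
qed

lemma recursion_rate_le_half: "recursion_rate \<rho> n \<le> 1 / 2"
proof -
  have "1 * recursion_rate \<rho> n \<le> \<beta> * recursion_rate \<rho> n"
    using beta rho by (intro mult_right_mono recursion_rate_nonneg) auto
  then show ?thesis using beta_recursion_rate_le eps by simp
qed

text \<open>
  The left-hand side is the cost of walk A plus \<open>recursion_rate\<close> many iterations of algorithm B, each of
  them an inner call at its own budget followed by a high power walk if that call succeeds. After
  division by \<open>C / \<epsilon>\<close> it is at most \<open>(n + 1) \<epsilon> + y * ((K + 1) \<epsilon> / \<epsilon>' - (n + 1) \<epsilon>)\<close>, where \<open>K = 7.57\<close> and
  \<open>y = \<beta> * recursion_rate \<rho> n\<close>. The bracket is at most \<open>8.57 * 9 / 7 - 4.5 \<le> 6.52\<close>, so the sum is at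
  most \<open>4.5 + 2 \<epsilon> + 2 / 7 * (1 - \<epsilon>) * 6.52 \<le> 6.5\<close>.
\<close>

lemma cost_recursion:
  "\<beta> * C * (real n - real (Suc n) * recursion_rate \<rho> n) +
     recursion_rate \<rho> n * (7.57 * (\<beta> * C) / \<epsilon>' + \<rho> * (\<beta> * C / (1 - \<rho>))) \<le> 7.57 * C / \<epsilon>"
proof -
  define y where "y = \<beta> * recursion_rate \<rho> n"
  have y: "0 \<le> y" "y \<le> 2 / 7 * (1 - \<epsilon>)"
    using beta_recursion_rate_le recursion_rate_nonneg[of \<rho> n] rho beta by (auto simp: y_def)
  have "\<rho> / (1 - \<rho>) \<le> 1 / \<epsilon>'" using rho eps'_pos by (intro frac_le) auto
  then have "\<beta> * C * (\<rho> / (1 - \<rho>)) \<le> \<beta> * C * (1 / \<epsilon>')"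
    using beta C by (intro mult_left_mono) auto
  then have "\<beta> * C * (real n - real (Suc n) * recursion_rate \<rho> n) +
     recursion_rate \<rho> n * (7.57 * (\<beta> * C) / \<epsilon>' + \<rho> * (\<beta> * C / (1 - \<rho>)))
    \<le> \<beta> * C * (real n - real (Suc n) * recursion_rate \<rho> n) +
     recursion_rate \<rho> n * (7.57 * (\<beta> * C) / \<epsilon>' + \<beta> * C * (1 / \<epsilon>'))"
    using beta C recursion_rate_nonneg[of \<rho> n] rho
    by (intro add_left_mono mult_left_mono) (auto simp: mult.commute)
  also have "\<dots> = C * (real (Suc n) + y * (8.57 / \<epsilon>' - real (Suc n)))"
    using beta(2)[symmetric] by (simp add: y_def algebra_simps add_divide_distrib)
  also have "\<dots> \<le> C * (7.57 / \<epsilon>)"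
  proof (intro mult_left_mono)
    have n_eps: "4.5 \<le> real (Suc n) * \<epsilon>" "real (Suc n) * \<epsilon> \<le> 4.5 + 2 * \<epsilon>"
      using walk_length_bounds eps by (simp_all add: algebra_simps)
    have "\<epsilon> / \<epsilon>' \<le> 9 / 7" using eps'_ge eps'_pos by (simp add: field_simps)
    then have "8.57 * (\<epsilon> / \<epsilon>') - real (Suc n) * \<epsilon> \<le> 6.52" using n_eps by simp
    then have "y * (8.57 * (\<epsilon> / \<epsilon>') - real (Suc n) * \<epsilon>) \<le> y * 6.52"
      using y by (intro mult_left_mono) auto
    also have "\<dots> \<le> (2 / 7 * (1 - \<epsilon>)) * 6.52" using y by (intro mult_right_mono) auto
    finally have "real (Suc n) * \<epsilon> + y * (8.57 * (\<epsilon> / \<epsilon>') - real (Suc n) * \<epsilon>) \<le> 7.57"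
      using n_eps eps by simp
    also have "real (Suc n) * \<epsilon> + y * (8.57 * (\<epsilon> / \<epsilon>') - real (Suc n) * \<epsilon>) =
      (real (Suc n) + y * (8.57 / \<epsilon>' - real (Suc n))) * \<epsilon>" by (simp add: algebra_simps)
    finally show "real (Suc n) + y * (8.57 / \<epsilon>' - real (Suc n)) \<le> 7.57 / \<epsilon>"
      using eps by (simp add: pos_le_divide_eq)
  qed (use C in auto)
  finally show ?thesis by (simp add: mult.commute)
qed

lemma inner_call: "factory_input p \<epsilon>' (\<beta> * C)"
  using eps'_pos eps'_less_1 C beta p rho by unfold_locales auto

end

section \<open>One round of the mutual recursion\<close>

text \<open>
  The common shape of both algorithms: give up if \<open>P\<close> fails, succeed if \<open>Q\<close> succeeds as well, and
  otherwise hand over to \<open>R\<close>. For the linear factory these are walk A, the free coin of bias \<open>1 / \<beta>\<close> and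
  algorithm B; for algorithm B they are the inner call, the high power factory and the next iteration.
\<close>

definition retry ::
  "(bool \<times> nat) spmf \<Rightarrow> (bool \<times> nat) spmf \<Rightarrow> (bool \<times> nat) spmf \<Rightarrow> (bool \<times> nat) spmf" where
  "retry P Q R = seq P (\<lambda>b. if b then seq Q (\<lambda>b. if b then return_spmf (True, 0) else R)
                              else return_spmf (False, 0))"

definition free_coin :: "real \<Rightarrow> (bool \<times> nat) spmf" where
  "free_coin q = map_spmf (\<lambda>b. (b, 0)) (spmf_of_pmf (bernoulli_pmf q))"

lemma do_eq_retry:
  "do { (b1, k1) \<leftarrow> P;
        if \<not> b1 then return_spmf (False, k1)
        else do {
          (b2, k2) \<leftarrow> Q;
          if b2 then return_spmf (True, k1 + k2)
          else do { (b, k) \<leftarrow> R; return_spmf (b, k1 + k2 + k) } } } = retry P Q R"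
  unfolding retry_def seq_def
  by (intro bind_spmf_cong refl)
    (auto simp: split_beta add.assoc intro!: bind_spmf_cong)

lemma do_eq_retry_free_coin:
  "do { (b1, k1) \<leftarrow> P;
        if \<not> b1 then return_spmf (False, k1)
        else do {
          b2 \<leftarrow> spmf_of_pmf (bernoulli_pmf q);
          if b2 then return_spmf (True, k1)
          else do { (b, k) \<leftarrow> R; return_spmf (b, k1 + k) } } } = retry P (free_coin q) R"
  unfolding do_eq_retry[symmetric] free_coin_def
  by (intro bind_spmf_cong refl) (auto simp: bind_map_pmf split: prod.split cong: if_cong)

lemma retry_True: "retry P (return_spmf (True, 0)) R = retry P (return_spmf (True, 0)) R'"
  by (simp add: retry_def seq_return_left cong: if_cong)

lemma cost_bound_free_coin:
  assumes "0 \<le> q" "q \<le> 1"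
  shows "cost_bound (free_coin q) q 0"
proof -
  have "map_spmf fst (free_coin q) = spmf_of_pmf (bernoulli_pmf q)"
    by (simp add: free_coin_def map_pmf_comp)
  moreover have "expected_flips (free_coin q) = 0"
    by (simp add: expected_flips_def free_coin_def nn_integral_map_spmf comp_def)
  ultimately show ?thesis using assms by (simp add: cost_bound_def out_prob_def)
qed

lemma cost_bound_retry:
  assumes P: "cost_bound P q T" and Q: "cost_bound Q h U" and R: "cost_bound R b V"
    and nonneg: "0 \<le> T" "0 \<le> U" "0 \<le> V"
  shows "cost_bound (retry P Q R) (q * (h + (1 - h) * b)) (T + q * (U + (1 - h) * V))"
proof -
  have h: "0 \<le> h" "h \<le> 1" using cost_bound_prob[OF Q] by auto
  have "cost_bound (seq Q (\<lambda>x. if x then return_spmf (True, 0) else R))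
      (h * (if True then 1 else b) + (1 - h) * (if False then 1 else b))
      (U + (h * (if True then 0 else V) + (1 - h) * (if False then 0 else V)))"
    using Q R nonneg cost_bound_return[of 0 True] by (intro cost_bound_seq) auto
  then have inner: "cost_bound (seq Q (\<lambda>x. if x then return_spmf (True, 0) else R)) (h + (1 - h) * b) (U + (1 - h) * V)"
    by simp
  have "cost_bound (retry P Q R)
      (q * (if True then h + (1 - h) * b else 0) + (1 - q) * (if False then h + (1 - h) * b else 0))
      (T + (q * (if True then U + (1 - h) * V else 0) + (1 - q) * (if False then U + (1 - h) * V else 0)))"
    unfolding retry_def using P inner nonneg h cost_bound_return[of 0 False]
    by (intro cost_bound_seq) auto
  then show ?thesis by simp
qed

lemma loss_retry_le:
  assumes P: "cost_bound P q T" and Q: "cost_bound Q h U" and "pmf Q None = 0"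
  shows "pmf (retry P Q R) None \<le> pmf P None + q * ((1 - h) * pmf R None)"
proof -
  have q: "0 \<le> q" using cost_bound_prob[OF P] by auto
  have "pmf (seq Q (\<lambda>x. if x then return_spmf (True, 0) else R)) None \<le> (1 - h) * pmf R None"
    using loss_seq_le[OF Q, of "\<lambda>x. if x then return_spmf (True, 0) else R"] assms(3) by simp
  then have "q * pmf (seq Q (\<lambda>x. if x then return_spmf (True, 0) else R)) None \<le> q * ((1 - h) * pmf R None)"
    using q by (intro mult_left_mono)
  moreover have "pmf (retry P Q R) None \<le> pmf P None + q * pmf (seq Q (\<lambda>x. if x then return_spmf (True, 0) else R)) None"
    unfolding retry_def
    using loss_seq_le[OF P, of "\<lambda>b. if b then seq Q (\<lambda>b. if b then return_spmf (True, 0) else R) else return_spmf (False, 0)"]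
    by simp
  ultimately show ?thesis by linarith
qed

context factory_input
begin

definition iteration_cost :: real where
  "iteration_cost = 7.57 * (\<beta> * C) / \<epsilon>' + \<rho> * (\<beta> * C / (1 - \<rho>))"

lemma iteration_cost_nonneg: "0 \<le> iteration_cost"
  using beta C eps'_pos rho by (simp add: iteration_cost_def)

lemma beta_C: "0 < \<beta> * C" using beta C by simp

lemma high_power_logistic_bf_eq:
  "high_power_logistic_bf p (int (Suc k) + 1 - 2) \<beta> C = walk_A p (int (Suc k)) (\<beta> * C) (int k)"
  by (simp add: high_power_logistic_bf_def walk_HP_eq_walk_A add.commute)

lemma cost_bound_high_power:
  "cost_bound (high_power_logistic_bf p (int (Suc k) + 1 - 2) \<beta> C) (hit_prob \<rho> (Suc k)) (\<beta> * C / (1 - \<rho>))"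
proof -
  have pos: "0 < geo_sum \<rho> (Suc k)" using rho by (intro geo_sum_pos) auto
  have "geo_sum \<rho> k / geo_sum \<rho> (Suc k) \<le> 1"
    using pos geo_sum_mono[of \<rho> k "Suc k"] rho by simp
  then have "real (Suc k) * (geo_sum \<rho> k / geo_sum \<rho> (Suc k)) \<le> real (Suc k) * 1"
    by (intro mult_left_mono) auto
  then have "\<beta> * C * (real (Suc k) * geo_sum \<rho> k / geo_sum \<rho> (Suc k) - real k) \<le> \<beta> * C * 1"
    using beta_C by (intro mult_left_mono) auto
  then have "ruin_cost (\<beta> * C) \<rho> (Suc k) k \<le> \<beta> * C / (1 - \<rho>)"
    unfolding ruin_cost_def using rho by (intro divide_right_mono) auto
  moreover have "ruin_prob \<rho> (Suc k) k = hit_prob \<rho> (Suc k)"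
    by (simp add: ruin_prob_def hit_prob_def)
  ultimately show ?thesis
    using cost_bound_walk_A[OF beta_C p refl, of "Suc k" k] rho
    unfolding high_power_logistic_bf_eq by (auto intro: cost_bound_mono)
qed

lemma high_power_lossless: "pmf (high_power_logistic_bf p (int (Suc k) + 1 - 2) \<beta> C) None = 0"
  unfolding high_power_logistic_bf_eq
  using walk_A_lossless[OF beta_C p refl, of "Suc k" k] rho by simp

text \<open>
  This ends the loop of algorithm B when its counter has come down to \<open>m = 2\<close>.
\<close>

lemma high_power_0: "high_power_logistic_bf p (int (Suc 0) + 1 - 2) \<beta> C = return_spmf (True, 0)"
  unfolding high_power_logistic_bf_eq using walk_A_boundary(1)[OF beta_C p refl, of "Suc 0"] rho by simp

definition walk_A_prob :: real where
  "walk_A_prob = \<rho> * geo_sum \<rho> n / geo_sum \<rho> (Suc n)"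

lemma alg_A_eq: "alg_A p (int n + 1) (\<beta> * C) = walk_A p (int (Suc n)) (\<beta> * C) (int 1)"
  by (simp add: alg_A_def add.commute)

text \<open>
  The cost of the walk started at \<open>1\<close>, rewritten by \<open>deficit_geo_sum\<close> so that the recursion rate appears.
\<close>

lemma cost_bound_alg_A:
  "cost_bound (alg_A p (int n + 1) (\<beta> * C)) walk_A_prob
     (\<beta> * C * (real n - real (Suc n) * recursion_rate \<rho> n))"
proof -
  have pos: "0 < geo_sum \<rho> (Suc n)" using rho by (intro geo_sum_pos) auto
  have "real (Suc n) / geo_sum \<rho> (Suc n) - 1 = (real (Suc n) - geo_sum \<rho> (Suc n)) / geo_sum \<rho> (Suc n)"
    using pos by (simp add: diff_divide_distrib del: geo_sum_simps)
  also have "\<dots> = (1 - \<rho>) * ((real n * geo_sum \<rho> (Suc n) - \<rho> * geo_deriv_sum \<rho> n) / geo_sum \<rho> (Suc n))"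
    unfolding deficit_geo_sum by (rule times_divide_eq_right[symmetric])
  also have "(real n * geo_sum \<rho> (Suc n) - \<rho> * geo_deriv_sum \<rho> n) / geo_sum \<rho> (Suc n) =
      real n - real (Suc n) * recursion_rate \<rho> n"
    unfolding recursion_rate_def using pos
    by (simp add: diff_divide_distrib del: geo_sum_simps of_nat_Suc)
  finally have "ruin_cost (\<beta> * C) \<rho> (Suc n) 1 = \<beta> * C * (real n - real (Suc n) * recursion_rate \<rho> n)"
    unfolding ruin_cost_def using rho by simp
  moreover have "ruin_prob \<rho> (Suc n) 1 = walk_A_prob"
    by (simp add: ruin_prob_def walk_A_prob_def)
  ultimately show ?thesis
    using cost_bound_walk_A[OF beta_C p refl, of "Suc n" 1] rho unfolding alg_A_eq by simp
qed

lemma alg_A_lossless: "pmf (alg_A p (int n + 1) (\<beta> * C)) None = 0"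
  unfolding alg_A_eq using walk_A_lossless[OF beta_C p refl, of "Suc n" 1] rho by simp

lemma inverse_beta: "1 / \<beta> = real n / real (Suc n)" "1 - 1 / \<beta> = 1 / real (Suc n)"
proof -
  have "\<beta> = real (Suc n) / real n" using n_gt by (simp add: inflation_def field_simps)
  then show "1 / \<beta> = real n / real (Suc n)" by simp
  then show "1 - 1 / \<beta> = 1 / real (Suc n)" by (simp add: field_simps)
qed

lemma cost_bound_coin: "cost_bound (free_coin (1 / \<beta>)) (1 / \<beta>) 0"
  using beta by (intro cost_bound_free_coin) auto

lemma coin_lossless: "pmf (free_coin (1 / \<beta>)) None = 0"
  by (simp add: free_coin_def pmf_None_eq_weight_spmf)

lemma recursion_rate_eq: "walk_A_prob * ((1 - 1 / \<beta>) * (loop_rate \<rho> n * W)) = recursion_rate \<rho> n * W"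
  unfolding walk_A_prob_def inverse_beta(2)
  using ruin_times_loop_rate[OF geo_sum_pos] rho n_gt by simp

lemma linear_prob: "walk_A_prob * (1 / \<beta> + (1 - 1 / \<beta>) * power_prob \<rho> n) = C * p"
proof -
  have "walk_A_prob * (1 / \<beta> + (1 - 1 / \<beta>) * power_prob \<rho> n) = \<rho> * (real n / real (Suc n))"
    unfolding walk_A_prob_def inverse_beta(2) unfolding inverse_beta(1)
    using rho n_gt by (intro ruin_times_power_prob) auto
  also have "\<dots> = \<rho> * (1 / \<beta>)" by (simp only: inverse_beta(1))
  also have "\<dots> = C * p" using beta by simp
  finally show ?thesis .
qed

lemma cost_bound_loop_step:
  assumes lin: "cost_bound L (\<beta> * C * p) (7.57 * (\<beta> * C) / \<epsilon>')"
    and R: "0 < k \<Longrightarrow> cost_bound R (power_prob \<rho> k) (loop_rate \<rho> k * iteration_cost)"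
  shows "cost_bound (retry L (high_power_logistic_bf p (int (Suc k) + 1 - 2) \<beta> C) R)
    (power_prob \<rho> (Suc k)) (loop_rate \<rho> (Suc k) * iteration_cost)"
proof -
  \<comment> \<open>For k = 0 the high power factory never fails, so R may be exchanged for a program
    whose bounds are those that the formulas give at 0.\<close>
  define R' where "R' = (if k = 0 then return_spmf (False, 0) else R)"
  have R': "cost_bound R' (power_prob \<rho> k) (loop_rate \<rho> k * iteration_cost)"
    using R cost_bound_return[of 0 False] by (auto simp: R'_def power_prob_def loop_rate_def)
  have "retry L (high_power_logistic_bf p (int (Suc k) + 1 - 2) \<beta> C) R =
      retry L (high_power_logistic_bf p (int (Suc k) + 1 - 2) \<beta> C) R'"
    using retry_True[of L R R'] high_power_0 by (cases "k = 0") (simp_all add: R'_def)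
  moreover have "cost_bound (retry L (high_power_logistic_bf p (int (Suc k) + 1 - 2) \<beta> C) R')
      (\<rho> * (hit_prob \<rho> (Suc k) + (1 - hit_prob \<rho> (Suc k)) * power_prob \<rho> k))
      (7.57 * (\<beta> * C) / \<epsilon>' + \<rho> * (\<beta> * C / (1 - \<rho>) + (1 - hit_prob \<rho> (Suc k)) * (loop_rate \<rho> k * iteration_cost)))"
    using lin cost_bound_high_power R'
    by (rule cost_bound_retry)
       (use beta_C eps'_pos rho loop_rate_nonneg iteration_cost_nonneg in auto)
  moreover have "7.57 * (\<beta> * C) / \<epsilon>' + \<rho> * (\<beta> * C / (1 - \<rho>) + (1 - hit_prob \<rho> (Suc k)) * (loop_rate \<rho> k * iteration_cost)) =
      loop_rate \<rho> (Suc k) * iteration_cost"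
    unfolding loop_rate_Suc[OF rho(1)] distrib_right distrib_left by (simp add: iteration_cost_def)
  ultimately show ?thesis by (simp only: power_prob_Suc[OF rho(1)])
qed

lemma cost_bound_linear_step:
  assumes "cost_bound R (power_prob \<rho> n) (loop_rate \<rho> n * iteration_cost)"
  shows "cost_bound (retry (alg_A p (int n + 1) (\<beta> * C)) (free_coin (1 / \<beta>)) R) (C * p) (7.57 * C / \<epsilon>)"
proof (rule cost_bound_mono)
  have "0 \<le> \<beta> * C * (real n - real (Suc n) * recursion_rate \<rho> n)"
  proof -
    have "real n - real (Suc n) * recursion_rate \<rho> n \<ge> real n - real (Suc n) * (1 / 2)"
      using recursion_rate_le_half by (intro diff_left_mono mult_left_mono) auto
    moreover have "real n - real (Suc n) * (1 / 2) \<ge> 0" using n_gt by simp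
    ultimately have "0 \<le> real n - real (Suc n) * recursion_rate \<rho> n" by linarith
    then show ?thesis using beta C by (intro mult_nonneg_nonneg) auto
  qed
  then show "cost_bound (retry (alg_A p (int n + 1) (\<beta> * C)) (free_coin (1 / \<beta>)) R) (C * p)
     (\<beta> * C * (real n - real (Suc n) * recursion_rate \<rho> n) + walk_A_prob * (0 + (1 - 1 / \<beta>) * (loop_rate \<rho> n * iteration_cost)))"
    using rho loop_rate_nonneg iteration_cost_nonneg
    by (subst linear_prob[symmetric])
      (intro cost_bound_retry cost_bound_alg_A cost_bound_coin assms, auto)
  show "\<beta> * C * (real n - real (Suc n) * recursion_rate \<rho> n) + walk_A_prob * (0 + (1 - 1 / \<beta>) * (loop_rate \<rho> n * iteration_cost))
     \<le> 7.57 * C / \<epsilon>"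
    using cost_recursion unfolding recursion_rate_eq add_0 iteration_cost_def .
qed

lemma run_linear_eq:
  "run_call p (Linear_Call \<epsilon> C) =
     retry (alg_A p (int n + 1) (\<beta> * C)) (free_coin (1 / \<beta>)) (run_call p (B_Call \<epsilon> (int n + 1) \<beta> C))"
  by (subst run_call.simps) (simp add: ceiling_eq[simplified] inflation_def do_eq_retry_free_coin Let_def)

lemma run_loop_eq:
  "run_call p (B_Call \<epsilon> (int (Suc k) + 1) \<beta> C) =
     retry (run_call p (Linear_Call \<epsilon>' (\<beta> * C))) (high_power_logistic_bf p (int (Suc k) + 1 - 2) \<beta> C)
       (run_call p (B_Call \<epsilon> (int k + 1) \<beta> C))"
  by (subst run_call.simps) (simp add: inner_gap_def do_eq_retry add.commute)

end

section \<open>The recursion as a least fixed point\<close>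

text \<open>
  The invariant of the fixed point induction, for both kinds of calls. Calls of algorithm B arise only
  with the inflation that belongs to their \<open>\<epsilon>\<close> and with a counter of at least \<open>2\<close>.
\<close>

definition within_budget :: "real \<Rightarrow> (bf_call \<Rightarrow> (bool \<times> nat) spmf) \<Rightarrow> bool" where
  "within_budget p f \<longleftrightarrow> (\<forall>\<epsilon> C. factory_input p \<epsilon> C \<longrightarrow>
     cost_bound (f (Linear_Call \<epsilon> C)) (C * p) (7.57 * C / \<epsilon>) \<and>
     (\<forall>k. cost_bound (f (B_Call \<epsilon> (int (Suc k) + 1) (inflation \<epsilon>) C))
        (power_prob (inflation \<epsilon> * C * p) (Suc k))
        (loop_rate (inflation \<epsilon> * C * p) (Suc k) * factory_input.iteration_cost p \<epsilon> C)))"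

lemma power_prob_bounds:
  assumes "0 \<le> \<rho>" "\<rho> \<le> 1"
  shows "0 \<le> power_prob \<rho> k" "power_prob \<rho> k \<le> 1"
  using assms geo_sum_ge[of \<rho> k k] geo_sum_nonneg[of \<rho> k] geo_sum_pos[of \<rho> k]
  by (auto simp: power_prob_def divide_le_eq_1)

lemma within_budget_run_call: "within_budget p (run_call p)"
proof (induction rule: run_call.fixp_induct)
  case 1
  show ?case
    unfolding within_budget_def curry_def
    by (intro admissible_all admissible_imp admissible_conj admissible_cost_bound mcont_call)
next
  case 2
  show ?case
    unfolding within_budget_def
  proof (intro allI impI conjI cost_bound_None)
    fix \<epsilon> C k assume "factory_input p \<epsilon> C"
    then interpret factory_input p \<epsilon> C .
    show "0 \<le> C * p" "C * p \<le> 1" using C p mean eps by auto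
    show "0 \<le> power_prob \<rho> (Suc k)" "power_prob \<rho> (Suc k) \<le> 1"
      using rho by (auto intro!: power_prob_bounds simp del: of_nat_Suc)
  qed
next
  case (3 f)
  have lin: "cost_bound (f p (Linear_Call \<epsilon> C)) (C * p) (7.57 * C / \<epsilon>)" if "factory_input p \<epsilon> C" for \<epsilon> C
    using 3 that by (simp add: within_budget_def)
  have loop: "cost_bound (f p (B_Call \<epsilon> (int (Suc k) + 1) (inflation \<epsilon>) C))
        (power_prob (inflation \<epsilon> * C * p) (Suc k))
        (loop_rate (inflation \<epsilon> * C * p) (Suc k) * factory_input.iteration_cost p \<epsilon> C)"
    if "factory_input p \<epsilon> C" for \<epsilon> C k
    using 3 that unfolding within_budget_def by blast
  show ?case
    unfolding within_budget_def
  proof (intro allI impI conjI, goal_cases)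
    case (1 \<epsilon> C)
    interpret factory_input p \<epsilon> C by (rule 1)
    obtain j where j: "n = Suc j" using n_gt by (cases n) auto
    show ?case
      using cost_bound_linear_step[OF loop[OF 1, of j, folded j]]
      by (simp add: ceiling_eq[simplified] do_eq_retry_free_coin Let_def inflation_def)
  next
    case (2 \<epsilon> C k)
    interpret factory_input p \<epsilon> C by (rule 2)
    have R: "cost_bound (f p (B_Call \<epsilon> (int k + 1) \<beta> C)) (power_prob \<rho> k) (loop_rate \<rho> k * iteration_cost)"
      if "0 < k" using that loop[OF 2, of "k - 1"] by simp
    have "int (Suc k) + 1 - 1 = int k + 1" by simp
    then show ?case
      using cost_bound_loop_step[OF lin[OF inner_call] R, unfolded inner_gap_def]
      by (simp only: bf_call.case do_eq_retry)
  qed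
qed

context factory_input
begin

lemma cost_bound_linear: "cost_bound (linear_bf p \<epsilon> C) (C * p) (7.57 * C / \<epsilon>)"
  using within_budget_run_call[of p] factory_input_axioms
  unfolding within_budget_def linear_bf_def by blast

text \<open>
  Each of the \<open>loop_rate\<close> many iterations makes one inner call, which is the only possible source of
  divergence.
\<close>

lemma loss_loop_le:
  assumes "pmf (linear_bf p \<epsilon>' (\<beta> * C)) None \<le> \<delta>"
  shows "pmf (run_call p (B_Call \<epsilon> (int (Suc k) + 1) \<beta> C)) None \<le> loop_rate \<rho> (Suc k) * \<delta>"
proof -
  interpret inner: factory_input p \<epsilon>' "\<beta> * C" by (rule inner_call)
  have step: "pmf (run_call p (B_Call \<epsilon> (int (Suc k) + 1) \<beta> C)) None \<le> \<delta> +
      \<rho> * ((1 - hit_prob \<rho> (Suc k)) * pmf (run_call p (B_Call \<epsilon> (int k + 1) \<beta> C)) None)" for k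
  proof -
    have "pmf (run_call p (B_Call \<epsilon> (int (Suc k) + 1) \<beta> C)) None \<le> pmf (linear_bf p \<epsilon>' (\<beta> * C)) None +
        \<rho> * ((1 - hit_prob \<rho> (Suc k)) * pmf (run_call p (B_Call \<epsilon> (int k + 1) \<beta> C)) None)"
      unfolding run_loop_eq[of k] linear_bf_def[symmetric]
      by (rule loss_retry_le[OF inner.cost_bound_linear cost_bound_high_power high_power_lossless])
    then show ?thesis using assms by linarith
  qed
  show ?thesis
  proof (induction k)
    case 0
    have "hit_prob \<rho> (Suc 0) = 1" "loop_rate \<rho> (Suc 0) = 1"
      by (simp_all add: hit_prob_def loop_rate_def)
    then show ?case using step[of 0] by simp
  next
    case (Suc k)
    have h: "0 \<le> 1 - hit_prob \<rho> (Suc (Suc k))"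
      using cost_bound_prob[OF cost_bound_high_power[of "Suc k"]] by simp
    have "pmf (run_call p (B_Call \<epsilon> (int (Suc (Suc k)) + 1) \<beta> C)) None \<le> \<delta> +
        \<rho> * ((1 - hit_prob \<rho> (Suc (Suc k))) * pmf (run_call p (B_Call \<epsilon> (int (Suc k) + 1) \<beta> C)) None)"
      by (rule step)
  also have "\<dots> \<le> \<delta> + \<rho> * ((1 - hit_prob \<rho> (Suc (Suc k))) * (loop_rate \<rho> (Suc k) * \<delta>))"
    using Suc.IH h rho by (intro add_left_mono mult_left_mono) auto
  also have "\<dots> = loop_rate \<rho> (Suc (Suc k)) * \<delta>"
    unfolding loop_rate_Suc[OF rho(1), of "Suc k"] by (simp add: distrib_right)
  finally show ?case .
  qed
qed

lemma loss_linear_le: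
  assumes "pmf (linear_bf p \<epsilon>' (\<beta> * C)) None \<le> \<delta>"
  shows "pmf (linear_bf p \<epsilon> C) None \<le> \<delta> / 2"
proof -
  obtain j where j: "n = Suc j" using n_gt by (cases n) auto
  have \<delta>: "0 \<le> \<delta>" using assms pmf_nonneg[of "linear_bf p \<epsilon>' (\<beta> * C)" None] by linarith
  have q: "0 \<le> walk_A_prob" "0 \<le> 1 - 1 / \<beta>"
    using cost_bound_prob[OF cost_bound_alg_A] cost_bound_prob[OF cost_bound_coin] by auto
  have "pmf (linear_bf p \<epsilon> C) None \<le>
      0 + walk_A_prob * ((1 - 1 / \<beta>) * pmf (run_call p (B_Call \<epsilon> (int n + 1) \<beta> C)) None)"
    unfolding linear_bf_def run_linear_eq
    using loss_retry_le[OF cost_bound_alg_A cost_bound_coin coin_lossless] by (simp add: alg_A_lossless)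
  also have "\<dots> \<le> 0 + walk_A_prob * ((1 - 1 / \<beta>) * (loop_rate \<rho> n * \<delta>))"
    using loss_loop_le[OF assms, of j] q by (intro add_left_mono mult_left_mono) (auto simp: j)
  also have "\<dots> = recursion_rate \<rho> n * \<delta>" by (simp add: recursion_rate_eq)
  also have "\<dots> \<le> 1 / 2 * \<delta>"
    using recursion_rate_le_half \<delta> by (intro mult_right_mono) auto
  finally show ?thesis by simp
qed

end

text \<open>
  Divergence requires an infinite nesting of inner calls. Each level of nesting halves the bound.
\<close>

lemma linear_bf_lossless:
  assumes "factory_input p \<epsilon> C"
  shows "pmf (linear_bf p \<epsilon> C) None = 0"
proof -
  have "pmf (linear_bf p \<epsilon> C) None \<le> (1 / 2) ^ i" for i
    using assms
  proof (induction i arbitrary: \<epsilon> C)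
    case 0
    show ?case by (simp add: pmf_le_1)
  next
    case (Suc i)
    interpret factory_input p \<epsilon> C by (rule Suc.prems)
    show ?case using loss_linear_le[OF Suc.IH[OF inner_call]] by simp
  qed
  moreover have "(\<lambda>i. (1 / 2 :: real) ^ i) \<longlonglongrightarrow> 0" by (rule LIMSEQ_power_zero) simp
  ultimately have "pmf (linear_bf p \<epsilon> C) None \<le> 0"
    by (intro LIMSEQ_le_const) auto
  then show ?thesis by (simp add: order_antisym)
qed

theorem lemma10:
  fixes \<epsilon> C p r :: real
  assumes "0 < \<epsilon>" and "\<epsilon> < 1"
    and "0 < C"
    and "0 \<le> p" and "p \<le> 1"
    and "r = C * p"
    and "r \<le> 1 - \<epsilon>"
  shows "map_spmf fst (linear_bf p \<epsilon> C) = spmf_of_pmf (bernoulli_pmf r) \<and>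
         expected_flips (linear_bf p \<epsilon> C) \<le> ennreal (7.57 * C / \<epsilon>)"
proof
  interpret factory_input p \<epsilon> C using assms by unfold_locales auto
  have r: "0 \<le> r" "r \<le> 1" using assms by auto
  have bound: "out_prob (linear_bf p \<epsilon> C) True \<le> r" "out_prob (linear_bf p \<epsilon> C) False \<le> 1 - r"
      "expected_flips (linear_bf p \<epsilon> C) \<le> ennreal (7.57 * C / \<epsilon>)"
    using cost_bound_linear assms by (auto simp: cost_bound_def)
  \<comment> \<open>Two upper bounds whose sum is the total mass are attained.\<close>
  have "out_prob (linear_bf p \<epsilon> C) True + out_prob (linear_bf p \<epsilon> C) False = 1"
    using weight_eq_out_prob[of "linear_bf p \<epsilon> C"] linear_bf_lossless[OF factory_input_axioms] by simp
  then have eq: "out_prob (linear_bf p \<epsilon> C) True = r" "out_prob (linear_bf p \<epsilon> C) False = 1 - r"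
    using bound by linarith+
  show "map_spmf fst (linear_bf p \<epsilon> C) = spmf_of_pmf (bernoulli_pmf r)"
  proof (rule spmf_eqI)
    fix b
    show "spmf (map_spmf fst (linear_bf p \<epsilon> C)) b = spmf (spmf_of_pmf (bernoulli_pmf r)) b"
      using eq r by (cases b) (simp_all add: out_prob_def)
  qed
  show "expected_flips (linear_bf p \<epsilon> C) \<le> ennreal (7.57 * C / \<epsilon>)" by (rule bound)
qed

end
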